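(* Let $\Lambda\subset \mathbb{R}^{2d}$ be a countable sequence of points with the property $\Lambda = - \Lambda$. For $(m,n)\in\Lambda$, with $m,n\in\mathbb{R}^d$, let $T_{m,n}$ be the associated translation-modulation transformation. For a function $g \in L^2(\mathbb{R}^d)$, assume that $\{ g_{m,n} = T_{m,n} (g): (m,n) \in \Lambda \}$ forms an orthonormal basis for $L^2(\mathbb{R}^d)$. Then for any two vectors $v, w \in \mathbb{R}^{2d}$ for which $\Omega(v, w) \neq 0$, we have $$\| Q_v (g) \|_2 \, \| Q_w (g) \|_2 = \infty .$$
   Context: The translation-modulation transformation on $L^2(\mathbb{R}^d)$ associated with $(m,n)$ is $T_{m,n}(g)(x) = e^{2\pi i n\cdot x} g(x+m)$. The standard symplectic form on $\mathbb{R}^{2d}$ is $\Omega((x,y),(\xi,\eta)) = x\cdot\eta - y\cdot\xi$ for $x,y,\xi,\eta\in\mathbb{R}^d$. For $v = (v^1,\ldots,v^{2d})\in\mathbb{R}^{2d}$ the differential operator $Q_v$ is $$Q_v(h)(x) = \frac{i}{2\pi}\sum_{k=1}^d v^{k+d}\frac{\partial h}{\partial x^k}(x) + \left(\sum_{k=1}^d v^k x^k\right) h(x),$$ with derivatives taken in the sense of (tempered) distributions. The norm $\|Q_v(g)\|_2$ is understood to be $\infty$ if the distribution $Q_v(g)$ is not in $L^2(\mathbb{R}^d)$. *)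

theory Defs
  imports "HOL-Analysis.Analysis"
begin

text \<open>
  Elements of \<open>L\<^sup>2(\<real>\<^sup>d)\<close> are represented by functions; nothing below distinguishes functions that
  agree almost everywhere.  The phase space \<open>\<real>\<^sup>2\<^sup>d\<close> is the product \<open>\<real>\<^sup>d \<times> \<real>\<^sup>d\<close>, so for
  \<open>v \<in> \<real>\<^sup>2\<^sup>d\<close> and \<open>1 \<le> k \<le> d\<close> the coordinates \<open>v\<^sup>k\<close> and \<open>v\<^sup>k\<^sup>+\<^sup>d\<close> are
  \<open>fst v $ k\<close> and \<open>snd v $ k\<close>.
\<close>

definition square_integrable :: "(real ^ 'd \<Rightarrow> complex) \<Rightarrow> bool" where
  "square_integrable f \<longleftrightarrow>
     f \<in> borel_measurable lebesgue \<and> integrable lebesgue (\<lambda>x. (norm (f x))\<^sup>2)"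

definition L2_inner :: "(real ^ 'd \<Rightarrow> complex) \<Rightarrow> (real ^ 'd \<Rightarrow> complex) \<Rightarrow> complex" where
  "L2_inner f g = (LINT x|lebesgue. f x * cnj (g x))"

text \<open>Only meaningful for square-integrable functions (the Bochner integral is 0 otherwise).\<close>

definition L2_norm :: "(real ^ 'd \<Rightarrow> complex) \<Rightarrow> real" where
  "L2_norm f = sqrt (LINT x|lebesgue. (norm (f x))\<^sup>2)"

text \<open>An orthonormal family whose finite linear combinations are dense.\<close>

definition L2_orthonormal_basis :: "'i set \<Rightarrow> ('i \<Rightarrow> real ^ 'd \<Rightarrow> complex) \<Rightarrow> bool" where
  "L2_orthonormal_basis I e \<longleftrightarrow>
     (\<forall>i\<in>I. square_integrable (e i)) \<and>
     (\<forall>i\<in>I. \<forall>j\<in>I. L2_inner (e i) (e j) = (if i = j then 1 else 0)) \<and>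
     (\<forall>f. square_integrable f \<longrightarrow>
        (\<forall>\<epsilon>>0. \<exists>F c. finite F \<and> F \<subseteq> I \<and> L2_norm (\<lambda>x. f x - (\<Sum>i\<in>F. c i * e i x)) < \<epsilon>))"

definition transl_mod ::
    "(real ^ 'd) \<times> (real ^ 'd) \<Rightarrow> (real ^ 'd \<Rightarrow> complex) \<Rightarrow> real ^ 'd \<Rightarrow> complex" where
  "transl_mod = (\<lambda>(m, n) g x. exp (2 * pi * \<i> * complex_of_real (n \<bullet> x)) * g (x + m))"

definition symplectic_form :: "(real ^ 'd) \<times> (real ^ 'd) \<Rightarrow> (real ^ 'd) \<times> (real ^ 'd) \<Rightarrow> real" where
  "symplectic_form = (\<lambda>(x, y) (\<xi>, \<eta>). x \<bullet> \<eta> - y \<bullet> \<xi>)"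

definition partial_deriv :: "'d \<Rightarrow> (real ^ 'd \<Rightarrow> complex) \<Rightarrow> real ^ 'd \<Rightarrow> complex" where
  "partial_deriv k f x = frechet_derivative f (at x) (axis k 1)"

text \<open>
  Iterated partial derivatives are indexed by the list of the directions of differentiation
  rather than by a multi-index.  Requiring all of them to be (Frechet) differentiable says
  that \<open>\<phi>\<close> is smooth.
\<close>

definition schwartz :: "(real ^ 'd \<Rightarrow> complex) \<Rightarrow> bool" where
  "schwartz \<phi> \<longleftrightarrow>
     (\<forall>ks. foldr partial_deriv ks \<phi> differentiable_on UNIV) \<and>
     (\<forall>ks N. bounded (range (\<lambda>x. norm x ^ N * norm (foldr partial_deriv ks \<phi> x))))"

text \<open>
  Tempered distributions are given by their values on Schwartz functions (values on other
  functions are irrelevant).  The pairing is bilinear, without complex conjugation.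
\<close>

type_synonym 'd distribution = "(real ^ 'd \<Rightarrow> complex) \<Rightarrow> complex"

definition dist_of :: "(real ^ 'd \<Rightarrow> complex) \<Rightarrow> 'd distribution" where
  "dist_of f = (\<lambda>\<phi>. LINT x|lebesgue. f x * \<phi> x)"

definition dist_deriv :: "'d::finite \<Rightarrow> 'd distribution \<Rightarrow> 'd distribution" where
  "dist_deriv k T = (\<lambda>\<phi>. - T (partial_deriv k \<phi>))"

definition dist_mult :: "(real ^ 'd \<Rightarrow> complex) \<Rightarrow> 'd distribution \<Rightarrow> 'd distribution" where
  "dist_mult p T = (\<lambda>\<phi>. T (\<lambda>x. p x * \<phi> x))"

definition Q_op :: "(real ^ 'd) \<times> (real ^ 'd) \<Rightarrow> 'd distribution \<Rightarrow> 'd distribution" where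
  "Q_op v T = (\<lambda>\<phi>.
     \<i> / (2 * pi) * (\<Sum>k\<in>UNIV. complex_of_real (snd v $ k) * dist_deriv k T \<phi>)
     + dist_mult (\<lambda>x. complex_of_real (\<Sum>k\<in>UNIV. fst v $ k * x $ k)) T \<phi>)"

definition dist_represented_by :: "'d::finite distribution \<Rightarrow> (real ^ 'd \<Rightarrow> complex) \<Rightarrow> bool" where
  "dist_represented_by T h \<longleftrightarrow> (\<forall>\<phi>. schwartz \<phi> \<longrightarrow> T \<phi> = dist_of h \<phi>)"

text \<open>The representing \<open>h\<close> is unique almost everywhere, so its norm does not depend on the choice.
  In \<open>ennreal\<close> one has \<open>0 * \<infinity> = 0\<close>, so a product of two such norms is infinite only if neither vanishes.\<close>

definition dist_L2_norm :: "'d::finite distribution \<Rightarrow> ennreal" where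
  "dist_L2_norm T =
     (if \<exists>h. square_integrable h \<and> dist_represented_by T h
      then ennreal (L2_norm (SOME h. square_integrable h \<and> dist_represented_by T h))
      else \<infinity>)"

end

theory Submission
  imports Defs "HOL-Probability.Distributions"
begin

text \<open>
  The unitary operators \<open>weyl (m, n) = exp (\<pi> i m \<bullet> n) T\<^sub>m\<^sub>,\<^sub>n\<close> satisfy
  \<open>weyl p (weyl q f) = exp (\<pi> i \<Omega>(p, q)) weyl (p + q) f\<close>, and \<open>- 2 \<pi> i Q\<^sub>v\<close> generates the
  group \<open>t \<mapsto> weyl (t J v)\<close>, where \<open>J (a, b) = (b, - a)\<close>.  Suppose that \<open>Q\<^sub>v g = h\<close> and
  \<open>Q\<^sub>w g = k\<close> are in \<open>L\<^sup>2\<close>.  Then the difference quotients of both groups at \<open>g\<close> converge in norm,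
  and the commutation relation gives \<open>\<langle>h, k\<rangle> - \<langle>k, h\<rangle> = i \<Omega>(v, w) \<parallel>g\<parallel>\<^sup>2 / (2 \<pi>) \<noteq> 0\<close>.

  On the other hand, \<open>\<langle>h, weyl p g\<rangle> = \<langle>weyl (- p) g, h\<rangle>\<close> whenever \<open>p = 0\<close> or \<open>g\<close> is orthogonal to
  \<open>weyl p g\<close>; in particular for \<open>p = \<lambda> - \<mu>\<close> with \<open>\<lambda>, \<mu> \<in> \<Lambda>\<close>.  For a fixed \<open>\<mu> \<in> \<Lambda>\<close> both
  \<open>weyl (\<lambda> - \<mu>) g\<close> and \<open>weyl (\<lambda> + \<mu>) g\<close> (\<open>\<lambda> \<in> \<Lambda>\<close>) are, up to phases, unitary images of the
  given basis.  Since \<open>\<Lambda> = - \<Lambda>\<close>, the reflection turns the Parseval expansion of \<open>\<langle>h, k\<rangle>\<close> in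
  the first basis into that of \<open>\<langle>k, h\<rangle>\<close> in the second, a contradiction.  The shift by \<open>\<mu>\<close> is
  needed because \<open>\<Lambda>\<close> need not contain \<open>0\<close>.

  It remains to exclude \<open>Q\<^sub>v g = 0\<close>, for which the product could be \<open>0 * \<infinity> = 0\<close>.  In this case
  \<open>g\<close> is invariant under \<open>weyl (t J v)\<close>, so the commutation relation makes \<open>weyl (s J w) g\<close>
  orthogonal to \<open>g\<close> for all \<open>s \<noteq> 0\<close>, contrary to continuity at \<open>s = 0\<close>.
\<close>

section \<open>The Hilbert space structure of square-integrable functions\<close>

lemma square_integrable_borel[measurable_dest]:
  "square_integrable f \<Longrightarrow> f \<in> borel_measurable lebesgue"
  by (simp add: square_integrable_def)

lemma borel_measurable_cnj:
  "f \<in> borel_measurable M \<Longrightarrow> (\<lambda>x. cnj (f x)) \<in> borel_measurable M"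
  by (rule measurable_compose[OF _ borel_measurable_continuous_onI]) (auto intro: continuous_intros)

lemma square_integrable_norm:
  "square_integrable f \<Longrightarrow> integrable lebesgue (\<lambda>x. (norm (f x))\<^sup>2)"
  by (simp add: square_integrable_def)

lemma square_integrable_bound:
  assumes "f \<in> borel_measurable lebesgue" "integrable lebesgue F" "\<And>x. (norm (f x))\<^sup>2 \<le> F x"
  shows "square_integrable f"
  unfolding square_integrable_def
proof
  show "integrable lebesgue (\<lambda>x. (norm (f x))\<^sup>2)"
  proof (rule Bochner_Integration.integrable_bound[OF assms(2)])
    show "(\<lambda>x. (norm (f x))\<^sup>2) \<in> borel_measurable lebesgue" using assms(1) by measurable
    show "AE x in lebesgue. norm ((norm (f x))\<^sup>2) \<le> norm (F x)"
      using assms(3) by (auto intro!: AE_I2 order_trans[OF _ abs_ge_self])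
  qed
qed fact

lemma square_integrable_add:
  assumes "square_integrable f" "square_integrable g"
  shows "square_integrable (\<lambda>x. f x + g x)"
proof (rule square_integrable_bound)
  show "(\<lambda>x. f x + g x) \<in> borel_measurable lebesgue" using assms by measurable
  show "integrable lebesgue (\<lambda>x. 2 * (norm (f x))\<^sup>2 + 2 * (norm (g x))\<^sup>2)"
    using assms by (intro Bochner_Integration.integrable_add integrable_mult_right
      square_integrable_norm)
  show "(norm (f x + g x))\<^sup>2 \<le> 2 * (norm (f x))\<^sup>2 + 2 * (norm (g x))\<^sup>2" for x
  proof -
    have "(norm (f x + g x))\<^sup>2 \<le> (norm (f x) + norm (g x))\<^sup>2"
      by (simp add: norm_triangle_ineq power_mono)
    also have "\<dots> \<le> 2 * (norm (f x))\<^sup>2 + 2 * (norm (g x))\<^sup>2"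
      using sum_squares_bound[of "norm (f x)" "norm (g x)"] by (simp add: power2_sum)
    finally show ?thesis .
  qed
qed

lemma square_integrable_scale:
  assumes "square_integrable f"
  shows "square_integrable (\<lambda>x. c * f x)"
  using assms unfolding square_integrable_def by (auto simp: norm_mult power_mult_distrib)

lemma square_integrable_diff:
  assumes "square_integrable f" "square_integrable g"
  shows "square_integrable (\<lambda>x. f x - g x)"
  using square_integrable_add[OF assms(1) square_integrable_scale[OF assms(2), of "-1"]] by simp

lemma square_integrable_0: "square_integrable (\<lambda>x. 0)"
  by (simp add: square_integrable_def)

lemma square_integrable_sum:
  assumes "\<And>i. i \<in> I \<Longrightarrow> square_integrable (f i)"
  shows "square_integrable (\<lambda>x. \<Sum>i\<in>I. f i x)"
  using assms
  by (induction I rule: infinite_finite_induct)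
    (auto intro: square_integrable_0 square_integrable_add)

lemma integrable_L2_product:
  assumes "square_integrable f" "square_integrable g"
  shows "integrable lebesgue (\<lambda>x. f x * cnj (g x))"
proof (rule Bochner_Integration.integrable_bound)
  show "integrable lebesgue (\<lambda>x. (norm (f x))\<^sup>2 + (norm (g x))\<^sup>2)"
    using assms by (intro Bochner_Integration.integrable_add square_integrable_norm)
  show "(\<lambda>x. f x * cnj (g x)) \<in> borel_measurable lebesgue" 
    using assms[THEN square_integrable_borel]
    by (intro borel_measurable_times borel_measurable_cnj)
  have "norm (f x * cnj (g x)) \<le> (norm (f x))\<^sup>2 + (norm (g x))\<^sup>2" for x
  proof -
    have "2 * (norm (f x) * norm (g x)) \<le> (norm (f x))\<^sup>2 + (norm (g x))\<^sup>2"
      using sum_squares_bound[of "norm (f x)" "norm (g x)"] by simp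
    moreover have "0 \<le> norm (f x) * norm (g x)" by simp
    ultimately show ?thesis unfolding norm_mult complex_mod_cnj by linarith
  qed
  then show "AE x in lebesgue. norm (f x * cnj (g x)) \<le> norm ((norm (f x))\<^sup>2 + (norm (g x))\<^sup>2)"
    by (auto intro!: AE_I2 order_trans[OF _ abs_ge_self])
qed

lemma square_integrable_cnj: "square_integrable f \<Longrightarrow> square_integrable (\<lambda>x. cnj (f x))"
  unfolding square_integrable_def by (auto intro: borel_measurable_cnj)

lemma integrable_L2_mult:
  assumes "square_integrable f" "square_integrable g"
  shows "integrable lebesgue (\<lambda>x. f x * g x)"
  using integrable_L2_product[OF assms(1) square_integrable_cnj[OF assms(2)]] by simp

section \<open>Sesquilinearity of the inner product and norm inequalities\<close>

lemma L2_inner_add_left: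
  assumes "square_integrable f" "square_integrable g" "square_integrable h"
  shows "L2_inner (\<lambda>x. f x + g x) h = L2_inner f h + L2_inner g h"
  unfolding L2_inner_def using assms
  by (simp add: ring_distribs integrable_L2_product Bochner_Integration.integral_add)

lemma L2_inner_scale_left: "L2_inner (\<lambda>x. c * f x) h = c * L2_inner f h"
  unfolding L2_inner_def by (simp add: mult.assoc)

lemma L2_inner_commute: "L2_inner f g = cnj (L2_inner g f)"
  unfolding L2_inner_def
    by (subst Bochner_Integration.integral_cnj[symmetric]) (simp add: mult.commute)

lemma L2_inner_scale_right: "L2_inner f (\<lambda>x. c * h x) = cnj c * L2_inner f h"
  by (subst (1 2) L2_inner_commute) (simp add: L2_inner_scale_left)

lemma L2_inner_diff_left:
  assumes "square_integrable f" "square_integrable g" "square_integrable h"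
  shows "L2_inner (\<lambda>x. f x - g x) h = L2_inner f h - L2_inner g h"
  using L2_inner_add_left[OF assms(1) square_integrable_scale[OF assms(2), of "-1"] assms(3)]
    L2_inner_scale_left[of "-1" g h] by simp

lemma L2_inner_add_right:
  assumes "square_integrable f" "square_integrable g" "square_integrable h"
  shows "L2_inner h (\<lambda>x. f x + g x) = L2_inner h f + L2_inner h g"
  by (subst (1 2 3) L2_inner_commute) (simp add: L2_inner_add_left assms)

lemma L2_inner_diff_right:
  assumes "square_integrable f" "square_integrable g" "square_integrable h"
  shows "L2_inner h (\<lambda>x. f x - g x) = L2_inner h f - L2_inner h g"
  by (subst (1 2 3) L2_inner_commute) (simp add: L2_inner_diff_left assms)

lemma L2_inner_sum_left:
  assumes "\<And>i. i \<in> I \<Longrightarrow> square_integrable (f i)" "square_integrable h"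
  shows "L2_inner (\<lambda>x. \<Sum>i\<in>I. c i * f i x) h = (\<Sum>i\<in>I. c i * L2_inner (f i) h)"
  using assms
proof (induction I rule: infinite_finite_induct)
  case (insert i I)
  have "L2_inner (\<lambda>x. \<Sum>i\<in>insert i I. c i * f i x) h
      = L2_inner (\<lambda>x. c i * f i x + (\<Sum>i\<in>I. c i * f i x)) h"
    using insert.hyps by simp
  also have "\<dots> = c i * L2_inner (f i) h + L2_inner (\<lambda>x. \<Sum>i\<in>I. c i * f i x) h"
    using insert by (subst L2_inner_add_left)
      (auto intro!: square_integrable_sum square_integrable_scale simp: L2_inner_scale_left)
  finally show ?case using insert by simp
qed (auto simp: L2_inner_def)

lemma L2_inner_sum_right:
  assumes "\<And>i. i \<in> I \<Longrightarrow> square_integrable (f i)" "square_integrable h"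
  shows "L2_inner h (\<lambda>x. \<Sum>i\<in>I. c i * f i x) = (\<Sum>i\<in>I. cnj (c i) * L2_inner h (f i))"
proof -
  have "L2_inner h (\<lambda>x. \<Sum>i\<in>I. c i * f i x) = cnj (\<Sum>i\<in>I. c i * L2_inner (f i) h)"
    by (subst L2_inner_commute) (simp only: L2_inner_sum_left[OF assms])
  also have "\<dots> = (\<Sum>i\<in>I. cnj (c i) * L2_inner h (f i))"
    by (simp flip: L2_inner_commute[of h])
  finally show ?thesis .
qed

lemma L2_inner_self: "L2_inner f f = complex_of_real ((L2_norm f)\<^sup>2)"
proof -
  have "L2_inner f f = (LINT x|lebesgue. complex_of_real ((norm (f x))\<^sup>2))"
    unfolding L2_inner_def by (simp only: complex_norm_square)
  also have "\<dots> = complex_of_real (LINT x|lebesgue. (norm (f x))\<^sup>2)"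
    by (rule integral_complex_of_real)
  finally show ?thesis by (simp add: L2_norm_def)
qed

lemma L2_norm_nonneg: "0 \<le> L2_norm f"
  by (simp add: L2_norm_def)

lemma L2_norm_scale: "L2_norm (\<lambda>x. c * f x) = norm c * L2_norm f"
  by (simp add: L2_norm_def norm_mult power_mult_distrib real_sqrt_mult)

lemma L2_norm_minus_commute: "L2_norm (\<lambda>x. f x - g x) = L2_norm (\<lambda>x. g x - f x)"
  by (simp add: L2_norm_def norm_minus_commute)

text \<open>Integrating the pointwise inequality
  \<open>2 |f g| \<le> t |f|\<^sup>2 + |g|\<^sup>2 / t\<close> and optimising over t > 0 gives the
  claim. If one norm vanishes, the optimum is only approached as t becomes very large or very
  small.\<close>

lemma L2_Cauchy_Schwarz:
  assumes f: "square_integrable f" and g: "square_integrable g"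
  shows "norm (L2_inner f g) \<le> L2_norm f * L2_norm g"
proof -
  let ?I = "norm (L2_inner f g)"
  let ?a = "L2_norm f" and ?b = "L2_norm g"
  have sq: "(LINT x|lebesgue. (norm (h x))\<^sup>2) = (L2_norm h)\<^sup>2" for h :: "real^'a \<Rightarrow> complex"
    by (simp add: L2_norm_def)
  have *: "2 * ?I \<le> t * ?a\<^sup>2 + ?b\<^sup>2 / t" if t: "t > 0" for t
  proof -
    have "2 * ?I \<le> 2 * (LINT x|lebesgue. norm (f x * cnj (g x)))"
      unfolding L2_inner_def by (simp add: integral_norm_bound)
    also have "\<dots> = (LINT x|lebesgue. 2 * norm (f x * cnj (g x)))" by simp
    also have "\<dots> \<le> (LINT x|lebesgue. t * (norm (f x))\<^sup>2 + (norm (g x))\<^sup>2 / t)"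
    proof (rule integral_mono)
      show "2 * norm (f x * cnj (g x)) \<le> t * (norm (f x))\<^sup>2 + (norm (g x))\<^sup>2 / t" for x
        using t sum_squares_bound[of "sqrt t * norm (f x)" "norm (g x) / sqrt t"]
        by (simp add: norm_mult power_mult_distrib power_divide)
    qed (use f g in \<open>auto intro!: integrable_norm integrable_L2_product square_integrable_norm
        integrable_mult_right integrable_divide Bochner_Integration.integrable_add\<close>)
    also have "\<dots> = t * ?a\<^sup>2 + ?b\<^sup>2 / t"
      using f g by (simp add: square_integrable_norm sq)
    finally show ?thesis .
  qed
  show ?thesis
  proof (cases "?a = 0 \<or> ?b = 0")
    case False
    then have "?a > 0" "?b > 0" using L2_norm_nonneg[of f] L2_norm_nonneg[of g] by linarith+
    \<comment> \<open>The minimising value \<open>t = ?b / ?a\<close> turns the right-hand side into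
      \<open>2 * ?a * ?b\<close>.\<close>
    then show ?thesis using *[of "?b / ?a"] by (simp add: power2_eq_square field_simps)
  next
    case True
    have "?I \<le> 0"
    proof (rule ccontr)
      assume "\<not> ?I \<le> 0"
      then have pos: "?I > 0" by linarith
      show False
      proof (cases "?a = 0")
        case True
        \<comment> \<open>With \<open>?a = 0\<close> only \<open>?b\<^sup>2 / t\<close> remains in
          the bound on \<open>2 * ?I\<close>; this t is large enough to push it below
          \<open>?I\<close>. The case \<open>?b = 0\<close> uses a small t in the same way.\<close>
        have "?b\<^sup>2 / ((?b\<^sup>2 + 1) / ?I) \<le> ?I"
          using pos by (simp add: field_simps add_pos_nonneg)
        moreover have "2 * ?I \<le> ?b\<^sup>2 / ((?b\<^sup>2 + 1) / ?I)"
          using *[of "(?b\<^sup>2 + 1) / ?I"] pos True by (simp add: add_nonneg_pos)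
        ultimately show False using pos by linarith
      next
        case False
        then have b: "?b = 0" using \<open>?a = 0 \<or> ?b = 0\<close> by simp
        have "?I / (?a\<^sup>2 + 1) * ?a\<^sup>2 \<le> ?I"
          using pos by (simp add: field_simps add_pos_nonneg)
        moreover have "2 * ?I \<le> ?I / (?a\<^sup>2 + 1) * ?a\<^sup>2"
          using *[of "?I / (?a\<^sup>2 + 1)"] pos b by (simp add: add_nonneg_pos)
        ultimately show False using pos by linarith
      qed
    qed
    then show ?thesis by (simp add: L2_norm_nonneg order_trans)
  qed
qed

lemma L2_norm_triangle:
  assumes f: "square_integrable f" and g: "square_integrable g"
  shows "L2_norm (\<lambda>x. f x + g x) \<le> L2_norm f + L2_norm g"
proof (rule power2_le_imp_le)
  let ?h = "\<lambda>x. f x + g x"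
  have "complex_of_real ((L2_norm ?h)\<^sup>2) = L2_inner ?h ?h" by (simp add: L2_inner_self)
  also have "\<dots> = L2_inner f f + L2_inner f g + (L2_inner g f + L2_inner g g)"
    using f g by (simp add: L2_inner_add_left L2_inner_add_right square_integrable_add)
  finally have "(L2_norm ?h)\<^sup>2 = Re (L2_inner f f + L2_inner f g + (L2_inner g f + L2_inner g g))"
    by (metis Re_complex_of_real)
  also have "\<dots> = (L2_norm f)\<^sup>2 + (L2_norm g)\<^sup>2 + 2 * Re (L2_inner f g)"
    unfolding L2_inner_self by (subst L2_inner_commute[of g f]) simp
  also have "\<dots> \<le> (L2_norm f)\<^sup>2 + (L2_norm g)\<^sup>2 + 2 * (L2_norm f * L2_norm g)"
    using L2_Cauchy_Schwarz[OF f g] complex_Re_le_cmod[of "L2_inner f g"] by linarith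
  finally show "(L2_norm ?h)\<^sup>2 \<le> (L2_norm f + L2_norm g)\<^sup>2" by (simp add: power2_sum)
qed (simp add: L2_norm_nonneg)

lemma L2_norm_triangle_diff:
  assumes "square_integrable f" "square_integrable g" "square_integrable h"
  shows "L2_norm (\<lambda>x. f x - h x) \<le> L2_norm (\<lambda>x. f x - g x) + L2_norm (\<lambda>x. g x - h x)"
  using L2_norm_triangle[of "\<lambda>x. f x - g x" "\<lambda>x. g x - h x"] assms
  by (simp add: square_integrable_diff)

text \<open>Density supplies one finite combination close to f. A Fourier sum over any larger finite
  index set does at least as well, being the best approximation from its span, and Cauchy-Schwarz
  passes to the pairing with h. Convergence along all finite subsets is what later permits
  reindexing by reflection.\<close>

theorem L2_Parseval:
  fixes e :: "'i \<Rightarrow> real ^ 'd \<Rightarrow> complex"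
  assumes onb: "L2_orthonormal_basis I e" and f: "square_integrable f" and h: "square_integrable h"
  shows "((\<lambda>i. L2_inner f (e i) * L2_inner (e i) h) has_sum L2_inner f h) I"
proof -
  have e: "square_integrable (e i)" if "i \<in> I" for i
    using onb that by (auto simp: L2_orthonormal_basis_def)
  have orth: "L2_inner (e i) (e j) = (if i = j then 1 else 0)" if "i \<in> I" "j \<in> I" for i j
    using onb that by (auto simp: L2_orthonormal_basis_def)
  define P where "P = (\<lambda>F x. \<Sum>i\<in>F. L2_inner f (e i) * e i x)"
  have P: "square_integrable (P F)" if "F \<subseteq> I" for F
    unfolding P_def using that e by (intro square_integrable_sum square_integrable_scale) auto
  have PI: "L2_inner (P F) k = (\<Sum>i\<in>F. L2_inner f (e i) * L2_inner (e i) k)"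
    if "F \<subseteq> I" "square_integrable k" for F k
    unfolding P_def using that e by (intro L2_inner_sum_left) auto
  \<comment> \<open>The residual u is orthogonal to the span over F, so
    \<open>\<langle>u, u\<rangle> = \<langle>u, f - s\<rangle>\<close> for each combination s over a
    subset of F; after Cauchy-Schwarz one factor of the norm of u cancels.\<close>
  have best: "L2_norm (\<lambda>x. f x - P F x) \<le> L2_norm (\<lambda>x. f x - (\<Sum>i\<in>G. c i * e i x))"
    if F: "finite F" "F \<subseteq> I" and G: "G \<subseteq> F" for F G c
  proof -
    let ?u = "\<lambda>x. f x - P F x" and ?s = "\<lambda>c G x. \<Sum>i\<in>G. c i * e i x"
    have u: "square_integrable ?u" using f P F by (intro square_integrable_diff) auto
    have s: "square_integrable (?s c G)" if "G \<subseteq> F" for c G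
      using that F e by (intro square_integrable_sum square_integrable_scale) auto
    have ue: "L2_inner ?u (e j) = 0" if j: "j \<in> F" for j
    proof -
      have "L2_inner (P F) (e j) = (\<Sum>i\<in>F. L2_inner f (e i) * (if i = j then 1 else 0))"
        using F j e by (subst PI) (auto intro!: sum.cong simp: orth subset_iff)
      also have "\<dots> = L2_inner f (e j)" using F j by (simp add: if_distrib cong: if_cong)
      finally show ?thesis using f P F e j by (subst L2_inner_diff_left) auto
    qed
    have us: "L2_inner ?u (?s c G) = 0" if "G \<subseteq> F" for c G
      using that F u e by (subst L2_inner_sum_right) (auto intro!: sum.neutral simp: ue subset_iff)
    have "L2_inner ?u ?u = L2_inner ?u f - L2_inner ?u (P F)"
      using f P F u by (intro L2_inner_diff_right) auto
    also have "L2_inner ?u (P F) = L2_inner ?u (?s c G)"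
      using us[OF G] us[of F] unfolding P_def by simp
    also have "L2_inner ?u f - L2_inner ?u (?s c G) = L2_inner ?u (\<lambda>x. f x - ?s c G x)"
      using f u s[OF G] by (intro L2_inner_diff_right[symmetric]) auto
    finally have "norm (L2_inner ?u ?u) \<le> L2_norm ?u * L2_norm (\<lambda>x. f x - ?s c G x)"
      using f u s[OF G] by (simp add: L2_Cauchy_Schwarz square_integrable_diff)
    then have "L2_norm ?u * L2_norm ?u \<le> L2_norm ?u * L2_norm (\<lambda>x. f x - ?s c G x)"
      unfolding L2_inner_self norm_of_real by (simp add: power2_eq_square)
    then show ?thesis
      using L2_norm_nonneg[of ?u] L2_norm_nonneg[of "\<lambda>x. f x - ?s c G x"]
      by (cases "L2_norm ?u = 0") (auto simp: mult_le_cancel_left)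
  qed
  show ?thesis
    unfolding has_sum_def tendsto_iff eventually_finite_subsets_at_top
  proof (intro allI impI)
    fix \<epsilon> :: real assume \<epsilon>: "\<epsilon> > 0"
    \<comment> \<open>The summand 1 keeps the denominator positive for null h and makes the final
      inequality strict.\<close>
    define \<delta> where "\<delta> = \<epsilon> / (L2_norm h + 1)"
    have "\<delta> > 0" using \<epsilon> L2_norm_nonneg[of h] by (simp add: \<delta>_def)
    then obtain F0 c where F0: "finite F0" "F0 \<subseteq> I" 
      and lt: "L2_norm (\<lambda>x. f x - (\<Sum>i\<in>F0. c i * e i x)) < \<delta>"
      using onb f unfolding L2_orthonormal_basis_def by blast
    show "\<exists>X. finite X \<and> X \<subseteq> I \<and> (\<forall>Y. finite Y \<and> X \<subseteq> Y \<and> Y \<subseteq> I \<longrightarrow>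
      dist (\<Sum>i\<in>Y. L2_inner f (e i) * L2_inner (e i) h) (L2_inner f h) < \<epsilon>)"
    proof (intro exI[of _ F0] conjI allI impI)
      fix Y assume Y: "finite Y \<and> F0 \<subseteq> Y \<and> Y \<subseteq> I"
      have "dist (\<Sum>i\<in>Y. L2_inner f (e i) * L2_inner (e i) h) (L2_inner f h)
          = norm (L2_inner f h - L2_inner (P Y) h)"
        using Y h by (simp add: PI dist_norm norm_minus_commute)
      also have "\<dots> = norm (L2_inner (\<lambda>x. f x - P Y x) h)"
        using f h P Y by (simp add: L2_inner_diff_left)
      also have "\<dots> \<le> L2_norm (\<lambda>x. f x - P Y x) * L2_norm h"
        using f h P Y by (intro L2_Cauchy_Schwarz square_integrable_diff) auto
      also have "\<dots> \<le> \<delta> * L2_norm h"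
        using best[of Y F0 c] Y lt by (intro mult_right_mono) (auto simp: L2_norm_nonneg)
      also have "\<dots> < \<epsilon>"
        using \<epsilon> L2_norm_nonneg[of h] by (simp add: \<delta>_def field_simps)
      finally show "dist (\<Sum>i\<in>Y. L2_inner f (e i) * L2_inner (e i) h) (L2_inner f h) < \<epsilon>" .
    qed (use F0 in auto)
  qed
qed

section \<open>Weyl operators\<close>

text \<open>The translation is an affine map with all scale factors 1, so the density in the change
  of variables is 1.\<close>

lemma lebesgue_distr_plus: "distr lebesgue lebesgue (\<lambda>x. x + m) = (lebesgue :: (real ^ 'd) measure)"
  and measurable_lebesgue_plus: "(\<lambda>x. x + m) \<in> lebesgue \<rightarrow>\<^sub>M (lebesgue :: (real ^ 'd) measure)"
proof -
  have "(\<lambda>x. m + (\<Sum>j\<in>Basis. (1 * (x \<bullet> j)) *\<^sub>R j)) = (\<lambda>x :: real ^ 'd. x + m)"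
    by (simp add: euclidean_representation add.commute)
  then show "distr lebesgue lebesgue (\<lambda>x. x + m) = (lebesgue :: (real ^ 'd) measure)"
    and "(\<lambda>x. x + m) \<in> lebesgue \<rightarrow>\<^sub>M (lebesgue :: (real ^ 'd) measure)"
    using lebesgue_affine_euclidean[of "\<lambda>_. 1" m] lebesgue_affine_measurable[of "\<lambda>_. 1" m]
    by (simp_all add: density_1)
qed

lemma borel_measurable_lebesgue_shift:
  fixes f :: "real ^ 'd \<Rightarrow> 'b::topological_space"
  assumes "f \<in> borel_measurable lebesgue"
  shows "(\<lambda>x. f (x + m)) \<in> borel_measurable lebesgue"
  using measurable_compose[OF measurable_lebesgue_plus assms] .

lemma integral_lebesgue_shift:
  fixes f :: "real ^ 'd \<Rightarrow> 'b::{banach, second_countable_topology}"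
  assumes "f \<in> borel_measurable lebesgue"
  shows "(LINT x|lebesgue. f (x + m)) = (LINT x|lebesgue. f x)"
  using integral_distr[OF measurable_lebesgue_plus[of m] assms] by (simp add: lebesgue_distr_plus)

lemma integrable_lebesgue_shift:
  fixes f :: "real ^ 'd \<Rightarrow> 'b::{banach, second_countable_topology}"
  assumes "integrable lebesgue f"
  shows "integrable lebesgue (\<lambda>x. f (x + m))"
  using integrable_distr[OF measurable_lebesgue_plus[of m], of f] assms
  by (simp add: lebesgue_distr_plus)

text \<open>The symmetric phase makes \<open>weyl (- p)\<close> the exact inverse of
  \<open>weyl p\<close> and \<open>t \<mapsto> weyl (t *\<^sub>R p)\<close> a one-parameter group;
  for \<open>transl_mod\<close> both hold only up to phases.\<close>

definition weyl :: "(real ^ 'd) \<times> (real ^ 'd) \<Rightarrow> (real ^ 'd \<Rightarrow> complex) \<Rightarrow> real ^ 'd \<Rightarrow> complex" where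
  "weyl p f = (\<lambda>x. cis (pi * (fst p \<bullet> snd p) + 2 * pi * (snd p \<bullet> x)) * f (x + fst p))"

lemma transl_mod_eq_weyl:
  "transl_mod p f = (\<lambda>x. cis (- pi * (fst p \<bullet> snd p)) * weyl p f x)"
proof
  fix x
  have "exp (2 * pi * \<i> * complex_of_real (snd p \<bullet> x)) = cis (2 * pi * (snd p \<bullet> x))"
    by (simp add: cis_conv_exp mult_ac)
  then show "transl_mod p f x = cis (- pi * (fst p \<bullet> snd p)) * weyl p f x"
    by (simp add: transl_mod_def weyl_def split_beta cis_mult flip: mult.assoc)
qed

lemma symplectic_form_eq: "symplectic_form p q = fst p \<bullet> snd q - snd p \<bullet> fst q"
  by (simp add: symplectic_form_def split_beta)

text \<open>The shift by \<open>fst p\<close> inside the modulation of q produces the cross term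
  \<open>2 * pi * (snd q \<bullet> fst p)\<close>. Subtracting the mixed terms in the phase of
  \<open>weyl (p + q)\<close> leaves pi times the symplectic form.\<close>

lemma weyl_comp: "weyl p (weyl q f) = (\<lambda>x. cis (pi * symplectic_form p q) * weyl (p + q) f x)"
proof
  fix x
  have 1: "pi * (fst p \<bullet> snd p) + 2 * pi * (snd p \<bullet> x)
      + (pi * (fst q \<bullet> snd q) + 2 * pi * (snd q \<bullet> (x + fst p)))
    = pi * symplectic_form p q
      + (pi * (fst (p + q) \<bullet> snd (p + q)) + 2 * pi * (snd (p + q) \<bullet> x))"
    by (simp add: symplectic_form_eq inner_add_left inner_add_right inner_commute[of "snd _"
      "fst _"]
        distrib_left right_diff_distrib)
  then show "weyl p (weyl q f) x = cis (pi * symplectic_form p q) * weyl (p + q) f x"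
    by (simp only: weyl_def mult.assoc[symmetric] cis_mult) (simp add: add_ac)
qed

lemma weyl_0: "weyl 0 f = f"
  by (simp add: weyl_def)

lemma weyl_minus_comp: "weyl (- p) (weyl p f) = f"
  by (simp add: weyl_comp weyl_0 symplectic_form_eq inner_commute[of "snd p"])

lemma weyl_scale: "weyl p (\<lambda>x. c * f x) = (\<lambda>x. c * weyl p f x)"
  by (simp add: weyl_def mult_ac)

lemma weyl_add: "weyl p (\<lambda>x. f x + g x) = (\<lambda>x. weyl p f x + weyl p g x)"
  by (simp add: weyl_def algebra_simps)

lemma weyl_diff: "weyl p (\<lambda>x. f x - g x) = (\<lambda>x. weyl p f x - weyl p g x)"
  by (simp add: weyl_def algebra_simps)

lemma borel_measurable_weyl:
  fixes f :: "real ^ 'd \<Rightarrow> complex"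
  assumes "f \<in> borel_measurable lebesgue"
  shows "weyl p f \<in> borel_measurable lebesgue"
proof -
  have "(\<lambda>x :: real ^ 'd. cis (pi * (fst p \<bullet> snd p) + 2 * pi * (snd p \<bullet> x)))
    \<in> borel_measurable lebesgue"
    by (intro measurable_completion)
      (auto simp: cis_conv_exp intro!: borel_measurable_continuous_onI continuous_intros)
  then show ?thesis
    unfolding weyl_def using borel_measurable_lebesgue_shift[OF assms]
      by (intro borel_measurable_times)
qed

lemma square_integrable_weyl:
  assumes "square_integrable f"
  shows "square_integrable (weyl p f)"
proof -
  have "integrable lebesgue (\<lambda>x. (norm (weyl p f x))\<^sup>2)"
    using integrable_lebesgue_shift[OF square_integrable_norm[OF assms]]
    by (simp add: weyl_def norm_mult)
  then show ?thesis
    using assms by (simp add: square_integrable_def borel_measurable_weyl)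
qed

lemma L2_inner_weyl:
  assumes "square_integrable f" "square_integrable g"
  shows "L2_inner (weyl p f) (weyl p g) = L2_inner f g"
proof -
  have "L2_inner (weyl p f) (weyl p g) = (LINT x|lebesgue. f (x + fst p) * cnj (g (x + fst p)))"
    unfolding L2_inner_def weyl_def
    by (rule Bochner_Integration.integral_cong) (simp_all add: cis_cnj cis_mult algebra_simps)
  also have "\<dots> = L2_inner f g"
    unfolding L2_inner_def
    by (rule integral_lebesgue_shift) (use integrable_L2_product[OF assms] in auto)
  finally show ?thesis .
qed

lemma L2_norm_weyl:
  assumes "square_integrable f"
  shows "L2_norm (weyl p f) = L2_norm f"
  using L2_inner_weyl[OF assms assms, of p]
  by (simp add: L2_inner_self power2_eq_iff_nonneg L2_norm_nonneg flip: of_real_power)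

lemma L2_inner_weyl_left:
  assumes "square_integrable f" "square_integrable g"
  shows "L2_inner (weyl p f) g = L2_inner f (weyl (- p) g)"
  using L2_inner_weyl[of f "weyl (- p) g" p] weyl_minus_comp[of "- p" g] assms
  by (simp add: square_integrable_weyl)

lemma L2_inner_weyl_right:
  assumes "square_integrable f" "square_integrable g"
  shows "L2_inner f (weyl p g) = L2_inner (weyl (- p) f) g"
  using L2_inner_weyl_left[of f g "- p"] assms by simp

text \<open>The transpose for the bilinear pairing reverses the translation only: without
  conjugation the modulation keeps its sign, unlike in the adjoint
  \<open>weyl (- p)\<close>.\<close>

lemma dist_of_weyl:
  assumes "square_integrable f" "square_integrable \<phi>"
  shows "dist_of (weyl (m, n) f) \<phi> = dist_of f (weyl (- m, n) \<phi>)"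
proof -
  have "dist_of (weyl (m, n) f) \<phi> = (LINT x|lebesgue. f (x + m) * weyl (- m, n) \<phi> (x + m))"
  proof -
    have 1: "pi * (m \<bullet> n) + 2 * pi * (n \<bullet> x) = pi * (- m \<bullet> n) + 2 * pi * (n \<bullet> (x + m))" for x
      by (simp add: inner_add_right inner_commute[of n m] distrib_left)
    show ?thesis
      unfolding dist_of_def weyl_def fst_conv snd_conv 1 by (simp add: mult_ac)
  qed
  also have "\<dots> = dist_of f (weyl (- m, n) \<phi>)"
    unfolding dist_of_def
    by (rule integral_lebesgue_shift)
      (use integrable_L2_mult[OF assms(1) square_integrable_weyl[OF assms(2)]] in auto)
  finally show ?thesis .
qed

text \<open>Expanding \<open>weyl (- q) f\<close> and \<open>weyl (- q) h\<close> in the given basis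
  amounts to expanding f and h in its image under \<open>weyl q\<close>. The phases between that
  image and \<open>weyl (p + q) g\<close> meet their conjugates and cancel.\<close>

lemma L2_Parseval_weyl:
  assumes onb: "L2_orthonormal_basis \<Lambda> (\<lambda>p. transl_mod p g)"
    and g: "square_integrable g" and f: "square_integrable f" and h: "square_integrable h"
  shows "((\<lambda>p. L2_inner f (weyl (p + q) g) * L2_inner (weyl (p + q) g) h) has_sum L2_inner f h) \<Lambda>"
proof -
  have "((\<lambda>p. L2_inner (weyl (- q) f) (transl_mod p g) * L2_inner (transl_mod p g) (weyl (- q) h))
      has_sum L2_inner (weyl (- q) f) (weyl (- q) h)) \<Lambda>"
    using f h by (intro L2_Parseval[OF onb] square_integrable_weyl)
  moreover have "L2_inner (weyl (- q) f) (transl_mod p g) * L2_inner (transl_mod p g) (weyl (- q) h)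
      = L2_inner f (weyl (p + q) g) * L2_inner (weyl (p + q) g) h" for p
  proof -
    have *: "cis a * cnj (cis a) = 1" for a by (simp add: cis_cnj cis_mult)
    have "L2_inner (weyl (- q) k) (transl_mod p g)
        = cnj (cis (- pi * (fst p \<bullet> snd p)) * cis (pi * symplectic_form q p)) * L2_inner k (weyl (p
          + q) g)"
      if "square_integrable k" for k
      unfolding transl_mod_eq_weyl L2_inner_scale_right
      using that g by (subst L2_inner_weyl_left)
        (auto simp: weyl_comp L2_inner_scale_right square_integrable_weyl add.commute)
    note 1 = this[OF f] and 2 = this[OF h]
    show ?thesis
      unfolding 1 L2_inner_commute[of "transl_mod p g"] L2_inner_commute[of "weyl (p + q) g"]
      unfolding 2 by (simp add: cis_cnj cis_mult mult_ac)
  qed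
  ultimately show ?thesis using f h by (simp add: L2_inner_weyl)
qed

section \<open>Polynomial multiples of Gaussians\<close>

lemma partial_deriv_at:
  assumes "(f has_derivative F) (at x)"
  shows "partial_deriv k f x = F (axis k 1)"
  unfolding partial_deriv_def using frechet_derivative_at[OF assms] by simp

lemma frechet_derivative_eq_partial_deriv:
  fixes f :: "real ^ 'd \<Rightarrow> complex"
  assumes "f differentiable (at x)"
  shows "frechet_derivative f (at x) m = (\<Sum>k\<in>UNIV. complex_of_real (m $ k) * partial_deriv k f x)"
proof -
  let ?D = "frechet_derivative f (at x)"
  have lin: "linear ?D" by (rule linear_frechet_derivative[OF assms])
  have "?D m = ?D (\<Sum>k\<in>UNIV. m $ k *\<^sub>R axis k 1)"
    using basis_expansion[of m] by (simp add: scalar_mult_eq_scaleR)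
  also have "\<dots> = (\<Sum>k\<in>UNIV. m $ k *\<^sub>R ?D (axis k 1))"
    using lin by (simp add: linear_sum linear_cmul o_def)
  finally show ?thesis by (simp add: partial_deriv_def scaleR_conv_of_real)
qed

text \<open>Generation by constants, coordinates, sums and products makes closure under partial
  derivatives and polynomial growth provable by one induction each.\<close>

inductive polynomial_map :: "(real ^ 'd \<Rightarrow> complex) \<Rightarrow> bool" where
  const: "polynomial_map (\<lambda>x. c)"
| coord: "polynomial_map (\<lambda>x. complex_of_real (x $ k))"
| add: "polynomial_map p \<Longrightarrow> polynomial_map q \<Longrightarrow> polynomial_map (\<lambda>x. p x + q x)"
| mult: "polynomial_map p \<Longrightarrow> polynomial_map q \<Longrightarrow> polynomial_map (\<lambda>x. p x * q x)"

lemma polynomial_map_sum: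
  assumes "\<And>i. i \<in> I \<Longrightarrow> polynomial_map (p i)"
  shows "polynomial_map (\<lambda>x. \<Sum>i\<in>I. p i x)"
  using assms by (induction I rule: infinite_finite_induct) (auto intro: polynomial_map.intros)

lemma polynomial_map_power:
  "polynomial_map p \<Longrightarrow> polynomial_map (\<lambda>x. p x ^ n)"
  by (induction n) (auto intro: polynomial_map.intros)

lemma polynomial_map_inner:
  "polynomial_map (\<lambda>x. complex_of_real (n \<bullet> x))"
  unfolding inner_vec_def of_real_sum
  by (auto intro!: polynomial_map_sum polynomial_map.intros)

lemma polynomial_map_shift:
  assumes "polynomial_map p"
  shows "polynomial_map (\<lambda>x. p (x + m))"
  using assms by induction (auto intro!: polynomial_map.intros)

lemma partial_deriv_add:
  assumes "f differentiable (at x)" "g differentiable (at x)"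
  shows "partial_deriv k (\<lambda>x. f x + g x) x = partial_deriv k f x + partial_deriv k g x"
  using assms[unfolded frechet_derivative_works]
  by (subst partial_deriv_at[OF has_derivative_add]) (auto simp: partial_deriv_def)

lemma partial_deriv_mult:
  assumes "f differentiable (at x)" "g differentiable (at x)"
  shows "partial_deriv k (\<lambda>x. f x * g x) x = f x * partial_deriv k g x + partial_deriv k f x * g x"
  using assms[unfolded frechet_derivative_works]
  by (subst partial_deriv_at[OF has_derivative_mult]) (auto simp: partial_deriv_def)

lemma partial_deriv_exp:
  assumes "f differentiable (at x)"
  shows "(\<lambda>x. exp (f x)) differentiable (at x)"
    and "partial_deriv k (\<lambda>x. exp (f x)) x = exp (f x) * partial_deriv k f x"
proof -
  have *: "((\<lambda>x. exp (f x)) has_derivative (\<lambda>h. exp (f x) * frechet_derivative f (at x) h)) (at x)"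
    using has_derivative_compose[OF assms[unfolded frechet_derivative_works]
        DERIV_exp[unfolded has_field_derivative_def]] .
  show "(\<lambda>x. exp (f x)) differentiable (at x)" using * by (auto simp: differentiable_def)
  show "partial_deriv k (\<lambda>x. exp (f x)) x = exp (f x) * partial_deriv k f x"
    using partial_deriv_at[OF *] by (simp add: partial_deriv_def)
qed

lemma polynomial_map_deriv:
  fixes p :: "real ^ 'd \<Rightarrow> complex"
  assumes "polynomial_map p"
  shows "(\<forall>x. p differentiable (at x)) \<and> (\<forall>k. polynomial_map (partial_deriv k p))"
  using assms
proof induction
  case (const c)
  have "partial_deriv k (\<lambda>x :: real ^ 'd. c) = (\<lambda>x. 0)" for k
    by (rule ext) (simp add: partial_deriv_at[OF has_derivative_const])
  then show ?case by (auto intro: polynomial_map.intros)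
next
  case (coord j)
  have d: "((\<lambda>x. complex_of_real (x $ j)) has_derivative (\<lambda>h. complex_of_real (h $ j))) (at x)"
    for x :: "real ^ 'd"
    by (intro bounded_linear_imp_has_derivative bounded_linear_compose[OF bounded_linear_of_real]
        bounded_linear_vec_nth)
  have "partial_deriv k (\<lambda>x :: real ^ 'd. complex_of_real (x $ j))
    = (\<lambda>x. complex_of_real (axis k 1 $ j))" for k
    by (rule ext) (simp add: partial_deriv_at[OF d])
  then show ?case using d by (auto intro: polynomial_map.intros simp: differentiable_def)
next
  case (add p q)
  have "partial_deriv k (\<lambda>x. p x + q x) = (\<lambda>x. partial_deriv k p x + partial_deriv k q x)" for k
    by (rule ext) (simp add: partial_deriv_add add.IH)
  then show ?case using add.IH by (auto intro!: polynomial_map.intros differentiable_add)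
next
  case (mult p q)
  have "partial_deriv k (\<lambda>x. p x * q x)
    = (\<lambda>x. p x * partial_deriv k q x + partial_deriv k p x * q x)" for k
    by (rule ext) (simp add: partial_deriv_mult mult.IH)
  then show ?case using mult by (auto intro!: polynomial_map.intros differentiable_mult)
qed

lemma polynomial_map_bound:
  assumes "polynomial_map p"
  shows "\<exists>C N. \<forall>x. norm (p x) \<le> C * (1 + norm x) ^ N"
  using assms
proof induction
  case (const c)
  show ?case by (rule exI[of _ "norm c"], rule exI[of _ 0]) simp
next
  case (coord k)
  have "norm (complex_of_real (x $ k)) \<le> 1 * (1 + norm x) ^ 1" for x :: "real ^ 'a"
    using component_le_norm_cart[of x k] by simp
  then show ?case by blast
next
  case (add p q)
  then obtain C N D M where b: "\<And>x. norm (p x) \<le> C * (1 + norm x) ^ N" "\<And>x. norm (q x)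
    \<le> D * (1 + norm x) ^ M"
    by blast
  have "C \<ge> 0" "D \<ge> 0" using b[of 0] by (auto intro: order_trans[OF norm_ge_zero])
  have "norm (p x + q x) \<le> (C + D) * (1 + norm x) ^ (N + M)" for x
  proof -
    have "norm (p x + q x) \<le> C * (1 + norm x) ^ N + D * (1 + norm x) ^ M"
      using b[of x] norm_triangle_ineq[of "p x" "q x"] by linarith
    also have "\<dots> \<le> C * (1 + norm x) ^ (N + M) + D * (1 + norm x) ^ (N + M)"
      using \<open>C \<ge> 0\<close> \<open>D \<ge> 0\<close> by (intro add_mono mult_left_mono power_increasing) auto
    finally show ?thesis by (simp add: algebra_simps)
  qed
  then show ?case by blast
next
  case (mult p q)
  then obtain C N D M where b: "\<And>x. norm (p x) \<le> C * (1 + norm x) ^ N" "\<And>x. norm (q x)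
    \<le> D * (1 + norm x) ^ M"
    by blast
  have "norm (p x * q x) \<le> (C * D) * (1 + norm x) ^ (N + M)" for x
  proof -
    have "norm (p x * q x) \<le> (C * (1 + norm x) ^ N) * (D * (1 + norm x) ^ M)"
      unfolding norm_mult using b[of x]
        by (intro mult_mono) (auto intro: order_trans[OF norm_ge_zero])
    then show ?thesis by (simp add: power_add mult_ac)
  qed
  then show ?case by blast
qed

text \<open>\<open>1 + r\<close> is at most a constant times
  \<open>1 + \<delta> * r\<^sup>2\<close>, hence times \<open>exp (\<delta> * r\<^sup>2)\<close>;
  the N-th power multiplies the exponent by N.\<close>

lemma power_le_exp_square:
  fixes \<epsilon> :: real
  assumes "\<epsilon> > 0"
  shows "\<exists>K>0. \<forall>r\<ge>0. (1 + r) ^ N \<le> K * exp (\<epsilon> * r\<^sup>2)"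
proof -
  \<comment> \<open>The second argument ensures \<open>N * \<delta> \<le> \<epsilon>\<close>, also
    for \<open>N = 0\<close>; \<open>\<delta> \<le> 1\<close> is used for
    \<open>1 + r\<^sup>2 \<le> (1 + \<delta> * r\<^sup>2) / \<delta>\<close>.\<close>
  define \<delta> where "\<delta> = min 1 (\<epsilon> / (real N + 1))"
  have \<delta>: "\<delta> > 0" "\<delta> \<le> 1" "real N * \<delta> \<le> \<epsilon>"
  proof -
    have "real N * \<delta> \<le> (real N + 1) * (\<epsilon> / (real N + 1))"
      using assms unfolding \<delta>_def by (intro mult_mono) auto
    then show "real N * \<delta> \<le> \<epsilon>" by simp
  qed (use assms in \<open>auto simp: \<delta>_def\<close>)
  have "(1 + r) ^ N \<le> (2 / \<delta>) ^ N * exp (\<epsilon> * r\<^sup>2)" if r: "r \<ge> 0" for r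
  proof -
    have "1 + r \<le> 2 * (1 + r\<^sup>2)"
    proof -
      have "2 * r \<le> 1 + r\<^sup>2" using sum_squares_bound[of 1 r] by simp
      moreover have "0 \<le> r\<^sup>2" by simp
      ultimately show ?thesis by argo
    qed
    also have "\<dots> \<le> 2 / \<delta> * (1 + \<delta> * r\<^sup>2)" using \<delta> by (simp add: field_simps)
    also have "\<dots> \<le> 2 / \<delta> * exp (\<delta> * r\<^sup>2)"
      using \<delta> by (intro mult_left_mono exp_ge_add_one_self) auto
    finally have "(1 + r) ^ N \<le> (2 / \<delta> * exp (\<delta> * r\<^sup>2)) ^ N" using r by (intro power_mono) auto
    also have "\<dots> = (2 / \<delta>) ^ N * exp (real N * \<delta> * r\<^sup>2)"
      by (simp add: power_mult_distrib exp_of_nat_mult mult.assoc power_divide)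
    also have "\<dots> \<le> (2 / \<delta>) ^ N * exp (\<epsilon> * r\<^sup>2)"
      using \<delta> by (intro mult_left_mono) (auto intro!: mult_right_mono)
    finally show ?thesis .
  qed
  then show ?thesis using \<delta> by (intro exI[of _ "(2 / \<delta>) ^ N"]) auto
qed

text \<open>
  Arbitrary polynomial exponents, not only quadratic ones, are allowed: the class then contains
  \<open>exp (- y\<^sup>2\<^sup>n)\<close>, which tends to the indicator of \<open>\<bar>y\<bar> < 1\<close>, and it is still closed under
  derivatives and Weyl operators.
\<close>

definition poly_gaussian :: "(real ^ 'd \<Rightarrow> complex) \<Rightarrow> bool" where
  "poly_gaussian f \<longleftrightarrow> (\<exists>p q C \<epsilon>. polynomial_map p \<and> polynomial_map q \<and> \<epsilon> > 0 \<and>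
     (\<forall>x. Re (q x) \<le> C - \<epsilon> * (norm x)\<^sup>2) \<and> f = (\<lambda>x. p x * exp (q x)))"

lemma poly_gaussianE:
  assumes "poly_gaussian f"
  obtains p q C \<epsilon> where "polynomial_map p" "polynomial_map q" "\<epsilon> > 0"
    "\<And>x. Re (q x) \<le> C - \<epsilon> * (norm x)\<^sup>2" "f = (\<lambda>x. p x * exp (q x))"
  using assms unfolding poly_gaussian_def by blast

lemma poly_gaussianI:
  assumes "polynomial_map p" "polynomial_map q" "\<epsilon> > 0" "\<And>x. Re (q x) \<le> C - \<epsilon> * (norm x)\<^sup>2"
  shows "poly_gaussian (\<lambda>x. p x * exp (q x))"
  using assms unfolding poly_gaussian_def by blast

lemma poly_gaussian_mult:
  assumes "poly_gaussian f" "polynomial_map r"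
  shows "poly_gaussian (\<lambda>x. r x * f x)"
  using assms(1)
proof (rule poly_gaussianE)
  fix p q :: "real ^ 'a \<Rightarrow> complex" and C \<epsilon>
  assume "polynomial_map p" "polynomial_map q" "\<epsilon> > 0" "\<And>x. Re (q x) \<le> C - \<epsilon> * (norm x)\<^sup>2"
    and f: "f = (\<lambda>x. p x * exp (q x))"
  then have "poly_gaussian (\<lambda>x. (r x * p x) * exp (q x))"
    using assms(2) by (intro poly_gaussianI polynomial_map.intros)
  then show ?thesis by (simp add: f mult.assoc)
qed

lemma poly_gaussian_bound:
  assumes "poly_gaussian f"
  shows "\<exists>C \<epsilon>. \<epsilon> > 0 \<and> C \<ge> 0 \<and> (\<forall>x. norm (f x) \<le> C * exp (- \<epsilon> * (norm x)\<^sup>2))"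
  using assms
proof (rule poly_gaussianE)
  fix p q :: "real ^ 'a \<Rightarrow> complex" and C \<epsilon>
  assume p: "polynomial_map p" and \<epsilon>: "\<epsilon> > 0" and q: "\<And>x. Re (q x) \<le> C - \<epsilon> * (norm x)\<^sup>2"
    and f: "f = (\<lambda>x. p x * exp (q x))"
  obtain D N where D: "\<And>x. norm (p x) \<le> D * (1 + norm x) ^ N" using polynomial_map_bound[OF p]
    by blast
  \<comment> \<open>Half of the decay rate is spent on the polynomial factor, the other half
    survives.\<close>
  obtain K where K: "K > 0" "\<And>r. r \<ge> 0 \<Longrightarrow> (1 + r) ^ N \<le> K * exp (\<epsilon> / 2 * r\<^sup>2)"
    using power_le_exp_square[of "\<epsilon> / 2" N] \<epsilon> by auto
  have "D \<ge> 0" using D[of 0] by (auto intro: order_trans[OF norm_ge_zero])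
  have "norm (f x) \<le> (D * K * exp C) * exp (- (\<epsilon> / 2) * (norm x)\<^sup>2)" for x
  proof -
    have "norm (f x) = norm (p x) * exp (Re (q x))" by (simp add: f norm_mult norm_exp_eq_Re)
    also have "\<dots> \<le> (D * (K * exp (\<epsilon> / 2 * (norm x)\<^sup>2))) * exp (C - \<epsilon> * (norm x)\<^sup>2)"
      using D[of x] K(2)[of "norm x"] \<open>D \<ge> 0\<close> q[of x]
      K(1)
      by (intro mult_mono order_trans[OF D[of x] mult_left_mono[OF K(2)]]) auto
    also have "\<dots> = (D * K * exp C) * (exp (\<epsilon> / 2 * (norm x)\<^sup>2) * exp (- \<epsilon> * (norm x)\<^sup>2))"
      by (simp add: exp_diff exp_minus field_simps)
    also have "\<dots> = (D * K * exp C) * exp (- (\<epsilon> / 2) * (norm x)\<^sup>2)"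
      by (simp flip: exp_add)
    finally show ?thesis .
  qed
  then show ?thesis using \<epsilon> \<open>D \<ge> 0\<close> K(1)
    by (intro exI[of _ "D * K * exp C"] exI[of _ "\<epsilon> / 2"]) auto
qed

text \<open>The product and chain rules change only the polynomial factor; the exponent, and with it
  the decay, stays the same.\<close>

lemma poly_gaussian_deriv:
  assumes "poly_gaussian f"
  shows "f differentiable (at x)" and "poly_gaussian (partial_deriv k f)"
proof -
  obtain p q C \<epsilon> where pq: "polynomial_map p" "polynomial_map q" "\<epsilon> > 0"
    "\<And>x. Re (q x) \<le> C - \<epsilon> * (norm x)\<^sup>2" and f: "f = (\<lambda>x. p x * exp (q x))"
    using assms by (rule poly_gaussianE) (rule that)
  have d: "p differentiable (at x)" "q differentiable (at x)"
    "(\<lambda>x. exp (q x)) differentiable (at x)" for x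
    using pq(1,2)[THEN polynomial_map_deriv] by (simp_all add: partial_deriv_exp(1))
  then show "f differentiable (at x)" unfolding f by (intro differentiable_mult) auto
  have "partial_deriv k f = (\<lambda>x. (p x * partial_deriv k q x + partial_deriv k p x) * exp (q x))"
    by (rule ext) (simp add: f partial_deriv_mult d partial_deriv_exp algebra_simps)
  moreover have "polynomial_map (\<lambda>x. p x * partial_deriv k q x + partial_deriv k p x)"
    using pq(1,2)[THEN polynomial_map_deriv] pq(1) by (intro polynomial_map.intros) auto
  ultimately show "poly_gaussian (partial_deriv k f)"
    using poly_gaussianI[OF _ pq(2-4)] by simp
qed

text \<open>This makes the distributional hypothesis on \<open>Q_op v (dist_of g)\<close> available
  for the class. Iterated derivatives stay in the class, and Gaussian decay beats every power of the
  norm.\<close>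

lemma schwartz_poly_gaussian:
  assumes "poly_gaussian f"
  shows "schwartz f"
proof -
  have *: "poly_gaussian (foldr partial_deriv ks f)" for ks
    by (induction ks) (auto intro: assms poly_gaussian_deriv)
  have "bounded (range (\<lambda>x. norm x ^ N * norm (foldr partial_deriv ks f x)))" for ks N
  proof -
    obtain C \<epsilon> where C: "\<epsilon> > 0" "C \<ge> 0" "\<And>x. norm (foldr partial_deriv ks f x)
      \<le> C * exp (- \<epsilon> * (norm x)\<^sup>2)"
      using poly_gaussian_bound[OF *] by blast
    obtain K where K: "K > 0" "\<And>r. r \<ge> 0 \<Longrightarrow> (1 + r) ^ N \<le> K * exp (\<epsilon> * r\<^sup>2)"
      using power_le_exp_square[OF C(1)] by blast
    have "norm x ^ N * norm (foldr partial_deriv ks f x) \<le> K * C" for x :: "real ^ 'a"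
    proof -
      have "norm x ^ N \<le> K * exp (\<epsilon> * (norm x)\<^sup>2)"
        using K(2)[of "norm x"] power_mono[of "norm x" "1 + norm x" N] by simp
      then have "norm x ^ N * norm (foldr partial_deriv ks f x)
          \<le> (K * exp (\<epsilon> * (norm x)\<^sup>2)) * (C * exp (- \<epsilon> * (norm x)\<^sup>2))"
        using C(3)[of x] K(1) by (intro mult_mono) auto
      also have "\<dots> = K * C * (exp (\<epsilon> * (norm x)\<^sup>2) * exp (- \<epsilon> * (norm x)\<^sup>2))" by (simp add: mult_ac)
      also have "\<dots> = K * C" by (simp flip: exp_add)
      finally show ?thesis .
    qed
    then show ?thesis by (auto simp: bounded_iff intro!: exI[of _ "K * C"])
  qed
  moreover have "foldr partial_deriv ks f differentiable_on UNIV" for ks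
    using poly_gaussian_deriv(1)[OF *] by (simp add: differentiable_on_def)
  ultimately show ?thesis by (simp add: schwartz_def)
qed

text \<open>Preserves quadratic decay under translation: half of the quadratic term survives, and
  the shift costs only a constant.\<close>

lemma norm_shift_square:
  fixes x m :: "'a::real_normed_vector"
  shows "(norm x)\<^sup>2 / 2 - (norm m)\<^sup>2 \<le> (norm (x + m))\<^sup>2"
proof -
  have "norm x \<le> norm (x + m) + norm m" using norm_triangle_ineq4[of "x + m" m] by simp
  then have "(norm x)\<^sup>2 \<le> (norm (x + m) + norm m)\<^sup>2" by (intro power_mono) auto
  also have "\<dots> \<le> 2 * (norm (x + m))\<^sup>2 + 2 * (norm m)\<^sup>2"
    using sum_squares_bound[of "norm (x + m)" "norm m"] by (simp add: power2_sum)
  finally show ?thesis by simp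
qed

text \<open>Modulation adds an imaginary polynomial to the exponent, which leaves its real part
  alone; translation costs half of the decay rate.\<close>

lemma poly_gaussian_weyl:
  assumes "poly_gaussian f"
  shows "poly_gaussian (weyl s f)"
proof -
  obtain p q C \<epsilon> where pq: "polynomial_map p" "polynomial_map q" "\<epsilon> > 0"
    "\<And>x. Re (q x) \<le> C - \<epsilon> * (norm x)\<^sup>2" and f: "f = (\<lambda>x. p x * exp (q x))"
    using assms by (rule poly_gaussianE) (rule that)
  let ?q = "\<lambda>x. q (x + fst s) + \<i> * complex_of_real (pi * (fst s \<bullet> snd s) + 2 * pi * (snd s \<bullet> x))"
  have "exp (?q x) = exp (q (x + fst s)) * cis (pi * (fst s \<bullet> snd s) + 2 * pi * (snd s \<bullet> x))" for x
    by (simp only: exp_add cis_conv_exp)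
  then have "weyl s f = (\<lambda>x. p (x + fst s) * exp (?q x))"
    unfolding weyl_def f by (simp only: mult_ac)
  moreover have "polynomial_map ?q"
  proof -
    have "complex_of_real (pi * (fst s \<bullet> snd s) + 2 * pi * (snd s \<bullet> x))
        = complex_of_real (pi * (fst s \<bullet> snd s)) + complex_of_real (((2 * pi) *\<^sub>R snd s) \<bullet> x)" for x
      by simp
    then show ?thesis
      using pq(2) by (simp only:) (intro polynomial_map.intros polynomial_map_shift
        polynomial_map_inner)
  qed
  moreover have "Re (?q x) \<le> (C + \<epsilon> * (norm (fst s))\<^sup>2) - \<epsilon> / 2 * (norm x)\<^sup>2" for x
    using pq(4)[of "x + fst s"] mult_left_mono[OF norm_shift_square[of x "fst s"], of \<epsilon>] pq(3)
    by (simp add: algebra_simps)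
  ultimately show ?thesis
    using poly_gaussianI[of "\<lambda>x. p (x + fst s)" ?q "\<epsilon> / 2" "C + \<epsilon> * (norm (fst s))\<^sup>2"] pq(1,3)
    by (simp add: polynomial_map_shift)
qed

text \<open>The Gaussian is the product of its one-dimensional factors, each of which is a multiple
  of a normal density.\<close>

lemma integrable_exp_minus_norm_square:
  fixes \<epsilon> :: real
  assumes "\<epsilon> > 0"
  shows "integrable lebesgue (\<lambda>x :: 'a::euclidean_space. exp (- \<epsilon> * (norm x)\<^sup>2))"
proof -
  interpret product_sigma_finite "\<lambda>_ :: 'a. lborel :: real measure" ..
  have 1: "integrable lborel (\<lambda>x :: real. exp (- \<epsilon> * x\<^sup>2))"
  proof -
    \<comment> \<open>The standard deviation with
      \<open>1 / (2 * \<sigma>\<^sup>2) = \<epsilon>\<close>.\<close>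
    define \<sigma> where "\<sigma> = sqrt (1 / (2 * \<epsilon>))"
    have \<sigma>: "\<sigma> > 0" "\<sigma>\<^sup>2 = 1 / (2 * \<epsilon>)" using assms by (auto simp: \<sigma>_def)
    have "integrable lborel (\<lambda>x. sqrt (2 * pi * \<sigma>\<^sup>2) * normal_density 0 \<sigma> x)"
      by (intro integrable_mult_right integrable_normal_density \<sigma>)
    then show ?thesis using \<sigma> assms by (simp add: normal_density_def mult.commute)
  qed
  have "integrable (\<Pi>\<^sub>M b\<in>Basis. lborel) (\<lambda>f. \<Prod>b\<in>(Basis :: 'a set). exp (- \<epsilon> * (f b)\<^sup>2))"
    using 1 by (intro product_integrable_prod) auto
  moreover have "(\<Prod>b\<in>(Basis :: 'a set). exp (- \<epsilon> * (f b)\<^sup>2))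
    = exp (- \<epsilon> * (norm (\<Sum>b\<in>(Basis :: 'a set). f b *\<^sub>R b))\<^sup>2)" for f
  proof -
    have "(norm (\<Sum>b\<in>(Basis :: 'a set). f b *\<^sub>R b))\<^sup>2 = (\<Sum>b\<in>(Basis :: 'a set). (f b)\<^sup>2)"
      unfolding power2_norm_eq_inner by (subst euclidean_inner) (simp add: power2_eq_square)
    then show ?thesis by (simp add: exp_sum sum_distrib_left)
  qed
  ultimately have "integrable (\<Pi>\<^sub>M b\<in>Basis. lborel) (\<lambda>f. exp (- \<epsilon> * (norm (\<Sum>b\<in>(Basis :: 'a set). f b
    *\<^sub>R b))\<^sup>2))"
    by simp
  then have "integrable lborel (\<lambda>x :: 'a. exp (- \<epsilon> * (norm x)\<^sup>2))"
    by (subst lborel_eq) (subst integrable_distr_eq, auto)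
  then show ?thesis by (subst integrable_completion) auto
qed

lemma square_integrable_gaussian_bound:
  assumes "f \<in> borel_measurable lebesgue" "\<epsilon> > 0" "\<And>x. norm (f x) \<le> C * exp (- \<epsilon> * (norm x)\<^sup>2)"
  shows "square_integrable f"
proof (rule square_integrable_bound[OF assms(1)])
  show "integrable lebesgue (\<lambda>x. C\<^sup>2 * exp (- (2 * \<epsilon>) * (norm x)\<^sup>2))"
    using assms(2) by (intro integrable_mult_right integrable_exp_minus_norm_square) auto
  show "(norm (f x))\<^sup>2 \<le> C\<^sup>2 * exp (- (2 * \<epsilon>) * (norm x)\<^sup>2)" for x
    using power_mono[OF assms(3)[of x], of 2]
      by (simp add: power_mult_distrib mult.assoc flip: exp_double)
qed

lemma borel_measurable_poly_gaussian:
  assumes "poly_gaussian f"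
  shows "f \<in> borel_measurable lebesgue"
proof -
  have "continuous_on UNIV f"
    using poly_gaussian_deriv(1)[OF assms] differentiable_imp_continuous_within
    by (auto simp: continuous_on_eq_continuous_within)
  then show ?thesis by (intro measurable_completion) (simp add: borel_measurable_continuous_onI)
qed

lemma square_integrable_poly_gaussian:
  assumes "poly_gaussian f"
  shows "square_integrable f"
  using poly_gaussian_bound[OF assms] square_integrable_gaussian_bound
    borel_measurable_poly_gaussian[OF assms]
  by blast

section \<open>Density of test functions\<close>

text \<open>Dominated convergence for the squared moduli.\<close>

lemma L2_norm_tendsto_0:
  fixes u :: "nat \<Rightarrow> real ^ 'd \<Rightarrow> complex"
  assumes F: "integrable lebesgue F" and u: "\<And>n. u n \<in> borel_measurable lebesgue"
    and bound: "\<And>n x. (norm (u n x))\<^sup>2 \<le> F x" and lim: "AE x in lebesgue. (\<lambda>n. u n x) \<longlonglongrightarrow> 0"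
  shows "(\<lambda>n. L2_norm (u n)) \<longlonglongrightarrow> 0"
proof -
  have "(\<lambda>n. LINT x|lebesgue. (norm (u n x))\<^sup>2) \<longlonglongrightarrow> (LINT x|(lebesgue :: (real ^ 'd) measure). 0)"
  proof (rule integral_dominated_convergence[where w = F])
    show "AE x in lebesgue. (\<lambda>n. (norm (u n x))\<^sup>2) \<longlonglongrightarrow> 0"
      using lim by eventually_elim (auto intro!: tendsto_eq_intros)
    show "(\<lambda>x. (norm (u n x))\<^sup>2) \<in> borel_measurable lebesgue" for n using u[of n] by measurable
  qed (use F bound in auto)
  then have "(\<lambda>n. sqrt (LINT x|lebesgue. (norm (u n x))\<^sup>2)) \<longlonglongrightarrow> sqrt 0"
    by (intro tendsto_real_sqrt) simp
  then show ?thesis by (simp add: L2_norm_def)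
qed

lemma integrable_indicator_box:
  "integrable lebesgue (indicator (box a b :: 'a::euclidean_space set) :: _ \<Rightarrow> real)"
  using emeasure_lborel_box_finite[of a b]
    by (intro integrable_real_indicator) (auto simp: less_top)

text \<open>The affine coordinates \<open>y k\<close> map the box onto the open cube of side 2
  around 0. There \<open>exp (- (\<Sum>k\<in>UNIV. y k x ^ (2 * Suc n)))\<close> tends to 1, and it
  tends to 0 outside the closed cube.\<close>

lemma box_gaussian_approximation:
  fixes a b :: "real ^ 'd"
  assumes "\<And>k. a $ k < b $ k"
  shows "\<exists>f. (\<forall>n. poly_gaussian (f n)) \<and> (\<lambda>n. L2_norm (\<lambda>x. indicator (box a b) x - f n x)) \<longlonglongrightarrow> 0"
proof -
  define c where "c = (1/2) *\<^sub>R (a + b)"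
  define r where "r = (\<lambda>k. (b $ k - a $ k) / 2)"
  have r: "r k > 0" for k using assms[of k] by (simp add: r_def)
  define y where "y = (\<lambda>k (x :: real ^ 'd). (x $ k - c $ k) / r k)"
  have y1: "\<bar>y k x\<bar> < 1 \<longleftrightarrow> a $ k < x $ k \<and> x $ k < b $ k" for k x
    using r[of k] by (simp add: y_def abs_less_iff divide_less_eq minus_divide_left[symmetric])
      (auto simp: c_def r_def field_simps)
  have y2: "\<bar>y k x\<bar> \<le> 1 \<longleftrightarrow> a $ k \<le> x $ k \<and> x $ k \<le> b $ k" for k x
    using r[of k] by (simp add: y_def abs_le_iff divide_le_eq minus_divide_left[symmetric])
      (auto simp: c_def r_def field_simps)
  \<comment> \<open>The exponents start at 2, so each summand is at least
    \<open>(y k x)\<^sup>2 - 1\<close>, whatever n is.\<close>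
  define S where "S = (\<lambda>n x. \<Sum>k\<in>UNIV. y k x ^ (2 * Suc n))"
  define f where "f = (\<lambda>n x. exp (- complex_of_real (S n x)))"
  have S0: "S n x \<ge> 0" for n x unfolding S_def by (intro sum_nonneg zero_le_even_power) simp
  define R where "R = (\<Sum>k\<in>UNIV. r k)"
  have rR: "r k \<le> R" for k unfolding R_def using r
    by (intro member_le_sum) (auto intro: less_imp_le)
  have R: "R > 0" unfolding R_def using r by (intro sum_pos) auto
  define \<epsilon> where "\<epsilon> = 1 / (2 * R\<^sup>2)"
  have \<epsilon>: "\<epsilon> > 0" using R by (simp add: \<epsilon>_def)
  define D where "D = real CARD('d) + (norm c)\<^sup>2 / R\<^sup>2"
  \<comment> \<open>As \<open>D\<close> and \<open>\<epsilon>\<close> do not depend on n, this one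
    bound gives both membership in the class and an integrable majorant for the whole
    sequence.\<close>
  have S: "- S n x \<le> D - \<epsilon> * (norm x)\<^sup>2" for n x
  proof -
    have "(norm (x - c))\<^sup>2 / R\<^sup>2 = (\<Sum>k\<in>UNIV. (x $ k - c $ k)\<^sup>2 / R\<^sup>2)"
      unfolding power2_norm_eq_inner inner_vec_def
        by (simp add: power2_eq_square sum_divide_distrib)
    also have "\<dots> \<le> (\<Sum>k\<in>UNIV. (y k x)\<^sup>2)"
      using r rR unfolding y_def power_divide
      by (intro sum_mono divide_left_mono power_mono mult_pos_pos zero_less_power)
        (auto intro: less_imp_le R)
    also have "\<dots> \<le> (\<Sum>k\<in>UNIV. 1 + y k x ^ (2 * Suc n))"
    proof (rule sum_mono)
      fix k
      show "(y k x)\<^sup>2 \<le> 1 + y k x ^ (2 * Suc n)"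
      proof (cases "(y k x)\<^sup>2 \<le> 1")
        case True
        then show ?thesis using zero_le_even_power[of "2 * Suc n" "y k x"] by simp
      next
        case False
        then have "((y k x)\<^sup>2) ^ 1 \<le> ((y k x)\<^sup>2) ^ Suc n" by (intro power_increasing) auto
        then show ?thesis by (simp add: power_mult power2_eq_square)
      qed
    qed
    also have "\<dots> = real CARD('d) + S n x" by (simp add: S_def sum.distrib)
    finally have 1: "(norm (x - c))\<^sup>2 / R\<^sup>2 \<le> real CARD('d) + S n x" .
    have "((norm x)\<^sup>2 / 2 - (norm c)\<^sup>2) / R\<^sup>2 \<le> (norm (x - c))\<^sup>2 / R\<^sup>2"
      using norm_shift_square[of x "- c"] by (intro divide_right_mono) auto
    with 1 show ?thesis by (simp add: D_def \<epsilon>_def diff_divide_distrib)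
  qed
  have f: "poly_gaussian (f n)" for n
  proof -
    have eq: "- complex_of_real (S n x)
        = (- 1) * (\<Sum>k\<in>UNIV. (complex_of_real (1 / r k) * (complex_of_real (x $ k)
          + complex_of_real (- c $ k))) ^ (2 * Suc n))" for x
      by (simp add: S_def y_def diff_divide_distrib)
    have "polynomial_map (\<lambda>x. - complex_of_real (S n x))"
      unfolding eq by (intro polynomial_map.intros polynomial_map_sum polynomial_map_power)
    then show ?thesis
      using poly_gaussianI[OF polynomial_map.const[of 1] _ \<epsilon>, of "\<lambda>x.
        - complex_of_real (S n x)" D] S
      unfolding f_def by simp
  qed
  have nf: "norm (f n x) = exp (- S n x)" for n x by (simp add: f_def norm_exp_eq_Re)
  let ?F = "\<lambda>x. 2 * indicator (box a b) x + 2 * (exp D * exp (- \<epsilon> * (norm x)\<^sup>2))"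
  have "(\<lambda>n. L2_norm (\<lambda>x. indicator (box a b) x - f n x)) \<longlonglongrightarrow> 0"
  proof (rule L2_norm_tendsto_0)
    show "integrable lebesgue ?F"
      using \<epsilon> by (intro Bochner_Integration.integrable_add integrable_mult_right
        integrable_exp_minus_norm_square)
        (auto intro: integrable_indicator_box)
    show "(\<lambda>x. indicator (box a b) x - f n x) \<in> borel_measurable lebesgue" for n
      using borel_measurable_poly_gaussian[OF f]
      by (intro borel_measurable_diff borel_measurable_indicator) auto
    show "(norm (indicator (box a b) x - f n x))\<^sup>2 \<le> ?F x" for n x
    proof -
      have "(norm (indicator (box a b) x - f n x))\<^sup>2 \<le> (indicator (box a b) x + norm (f n x))\<^sup>2"
        using norm_triangle_ineq4[of "indicator (box a b) x" "f n x"]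
        by (intro power_mono) (auto simp: indicator_def)
      also have "\<dots> \<le> 2 * indicator (box a b) x + 2 * (norm (f n x))\<^sup>2"
        using sum_squares_bound[of 1 "norm (f n x)"] by (auto simp: indicator_def power2_sum)
      also have "(norm (f n x))\<^sup>2 \<le> exp (- S n x)"
        using S0[of n x] by (simp add: nf flip: exp_double)
      also have "exp (- S n x) \<le> exp D * exp (- \<epsilon> * (norm x)\<^sup>2)"
        using S[of n x] by (simp flip: exp_add)
      finally show ?thesis by simp
    qed
    \<comment> \<open>Convergence can fail only on the boundary of the box, which is a null
      set.\<close>
    have "AE x in lebesgue. x \<notin> cbox a b - box a b"
      using negligible_frontier_interval[of a b] unfolding negligible_iff_null_sets
        by (rule AE_not_in)
    then show "AE x in lebesgue. (\<lambda>n. indicator (box a b) x - f n x) \<longlonglongrightarrow> 0"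
    proof eventually_elim
      case (elim x)
      show ?case
      proof (cases "x \<in> box a b")
        case True
        then have "\<bar>y k x\<bar> < 1" for k by (simp add: y1 mem_box_cart)
        then have "(\<lambda>n. ((y k x)\<^sup>2) ^ Suc n) \<longlonglongrightarrow> 0" for k
          by (intro LIMSEQ_Suc LIMSEQ_power_zero) (simp add: abs_square_less_1)
        then have "(\<lambda>n. S n x) \<longlonglongrightarrow> 0"
          unfolding S_def power_mult by (intro tendsto_null_sum) auto
        then have "(\<lambda>n. indicator (box a b) x - f n x)
          \<longlonglongrightarrow> indicator (box a b) x - exp (- complex_of_real 0)"
          unfolding f_def by (intro tendsto_intros)
        then show ?thesis using True by simp
      next
        case False
        then have "x \<notin> cbox a b" using elim by simp
        then obtain k where "\<not> (a $ k \<le> x $ k \<and> x $ k \<le> b $ k)" by (auto simp: mem_box_cart)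
        then have k: "\<bar>y k x\<bar> > 1" using y2[of k x] by linarith
        have "(y k x)\<^sup>2 > 1" using k by (simp add: abs_square_le_1 not_le[symmetric])
        moreover have "filterlim (\<lambda>n. z ^ n) at_top sequentially" if "z > 1" for z :: real
          using that by (intro filterlim_at_infinity_imp_filterlim_at_top
            filterlim_realpow_sequentially_gt1
              always_eventually allI zero_less_power) auto
        ultimately have "filterlim (\<lambda>n. ((y k x)\<^sup>2) ^ Suc n) at_top sequentially"
          by (intro filterlim_compose[OF _ filterlim_Suc]) auto
        moreover have "((y k x)\<^sup>2) ^ Suc n \<le> S n x" for n
          unfolding S_def power_mult[symmetric] by (intro member_le_sum zero_le_even_power) auto
        ultimately have "filterlim (\<lambda>n. S n x) at_top sequentially"
          by (auto intro: filterlim_at_top_mono)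
        then have "(\<lambda>n. exp (- S n x)) \<longlonglongrightarrow> 0"
          by (intro filterlim_compose[OF exp_at_bot] filterlim_compose[OF
            filterlim_uminus_at_bot_at_top])
        then have "(\<lambda>n. f n x) \<longlonglongrightarrow> 0" by (subst tendsto_norm_zero_iff[symmetric]) (simp add: nf)
        then show ?thesis using False by (auto intro: tendsto_eq_intros)
      qed
    qed
  qed
  then show ?thesis using f by blast
qed

lemma L2_norm_diff_eq_0:
  assumes "AE x in lebesgue. f x = g x"
  shows "L2_norm (\<lambda>x. f x - g x) = 0"
proof -
  have "(LINT x|lebesgue. (norm (f x - g x))\<^sup>2) = 0"
    using assms by (intro integral_eq_zero_AE) auto
  then show ?thesis by (simp add: L2_norm_def)
qed

lemma square_integrable_indicator:
  assumes "A \<in> sets lebesgue" "emeasure lebesgue A < \<infinity>"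
  shows "square_integrable (indicator A)"
proof -
  have "(\<lambda>x. (norm (indicator A x :: complex))\<^sup>2) = (indicator A :: _ \<Rightarrow> real)"
    by (auto simp: indicator_def)
  then show ?thesis
    unfolding square_integrable_def using assms
      by (auto simp: borel_measurable_indicator integrable_indicator_iff)
qed

text \<open>
  Instances take for \<open>R\<close> the linear property that is to be extended by density; it then has to be
  checked for a single \<open>poly_gaussian\<close> function only.
\<close>

locale L2_test_space =
  fixes R :: "(real ^ 'd \<Rightarrow> complex) \<Rightarrow> bool"
  assumes poly_gaussian: "poly_gaussian f \<Longrightarrow> R f"
    and add: "R f \<Longrightarrow> R g \<Longrightarrow> R (\<lambda>x. f x + g x)"
    and scale: "R f \<Longrightarrow> R (\<lambda>x. c * f x)"
    and square_integrable: "R f \<Longrightarrow> square_integrable f"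
begin

definition approximable :: "(real ^ 'd \<Rightarrow> complex) \<Rightarrow> bool" where
  "approximable f \<longleftrightarrow> square_integrable f \<and> (\<forall>\<epsilon>>0. \<exists>\<phi>. R \<phi> \<and> L2_norm (\<lambda>x. f x - \<phi> x) < \<epsilon>)"

lemma approximable_square_integrable: "approximable f \<Longrightarrow> square_integrable f"
  by (simp add: approximable_def)

lemma approximable_R: "R f \<Longrightarrow> approximable f"
  unfolding approximable_def by (auto simp: square_integrable L2_norm_def intro!: exI[of _ f])

lemma approximable_closed:
  assumes f: "square_integrable f" and "\<And>\<epsilon>. \<epsilon> > 0 \<Longrightarrow> \<exists>h. approximable h
    \<and> L2_norm (\<lambda>x. f x - h x) < \<epsilon>"
  shows "approximable f"
  unfolding approximable_def
proof (intro conjI allI impI)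
  fix \<epsilon> :: real assume "\<epsilon> > 0"
  then obtain h where h: "approximable h" "L2_norm (\<lambda>x. f x - h x) < \<epsilon> / 2"
    using assms(2)[of "\<epsilon> / 2"] by auto
  then obtain \<phi> where \<phi>: "R \<phi>" "L2_norm (\<lambda>x. h x - \<phi> x) < \<epsilon> / 2"
    using \<open>\<epsilon> > 0\<close> half_gt_zero unfolding approximable_def by blast
  have "L2_norm (\<lambda>x. f x - \<phi> x) < \<epsilon>"
    using L2_norm_triangle_diff[OF f, of h \<phi>] h \<phi>
      by (simp add: square_integrable approximable_square_integrable)
  with \<phi> show "\<exists>\<phi>. R \<phi> \<and> L2_norm (\<lambda>x. f x - \<phi> x) < \<epsilon>" by blast
qed fact

lemma approximable_limit:
  assumes "square_integrable f" "\<And>n. approximable (h n)" "(\<lambda>n. L2_norm (\<lambda>x. f x - h n x)) \<longlonglongrightarrow> 0"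
  shows "approximable f"
proof (rule approximable_closed[OF assms(1)])
  fix \<epsilon> :: real assume "\<epsilon> > 0"
  then have "\<forall>\<^sub>F n in sequentially. L2_norm (\<lambda>x. f x - h n x) < \<epsilon>"
    using order_tendstoD(2)[OF assms(3)] by simp
  then show "\<exists>h. approximable h \<and> L2_norm (\<lambda>x. f x - h x) < \<epsilon>"
    using assms(2) by (auto simp: eventually_sequentially)
qed

lemma approximable_cong_AE:
  assumes "approximable f" "square_integrable g" "AE x in lebesgue. f x = g x"
  shows "approximable g"
  using assms
  by (intro approximable_limit[of g "\<lambda>_. f"])
    (auto simp: L2_norm_minus_commute[of g f] L2_norm_diff_eq_0 approximable_square_integrable)

lemma approximable_scale:
  assumes "approximable f"
  shows "approximable (\<lambda>x. c * f x)"
proof (rule approximable_closed)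
  fix \<epsilon> :: real assume \<epsilon>: "\<epsilon> > 0"
  have "\<epsilon> / (norm c + 1) > 0" using \<epsilon> by (simp add: add_nonneg_pos)
  then obtain \<phi> where \<phi>: "R \<phi>" "L2_norm (\<lambda>x. f x - \<phi> x) < \<epsilon> / (norm c + 1)"
    using assms unfolding approximable_def by blast
  have "L2_norm (\<lambda>x. c * f x - c * \<phi> x) = norm c * L2_norm (\<lambda>x. f x - \<phi> x)"
    by (simp add: L2_norm_scale flip: right_diff_distrib)
  also have "\<dots> \<le> norm c * (\<epsilon> / (norm c + 1))" using \<phi> by (intro mult_left_mono) auto
  also have "\<dots> < \<epsilon>" using \<epsilon>
    by (auto simp: pos_divide_less_eq add_nonneg_pos distrib_left mult.commute)
  finally show "\<exists>h. approximable h \<and> L2_norm (\<lambda>x. c * f x - h x) < \<epsilon>"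
    using \<phi> scale approximable_R by blast
qed (use assms approximable_square_integrable square_integrable_scale in auto)

lemma approximable_add:
  assumes "approximable f" "approximable g"
  shows "approximable (\<lambda>x. f x + g x)"
proof (rule approximable_closed)
  fix \<epsilon> :: real assume \<epsilon>: "\<epsilon> > 0"
  obtain \<phi> where \<phi>: "R \<phi>" "L2_norm (\<lambda>x. f x - \<phi> x) < \<epsilon> / 2"
    using assms(1) half_gt_zero[OF \<epsilon>] unfolding approximable_def by blast
  obtain \<psi> where \<psi>: "R \<psi>" "L2_norm (\<lambda>x. g x - \<psi> x) < \<epsilon> / 2"
    using assms(2) half_gt_zero[OF \<epsilon>] unfolding approximable_def by blast
  have "L2_norm (\<lambda>x. (f x + g x) - (\<phi> x + \<psi> x)) = L2_norm (\<lambda>x. (f x - \<phi> x) + (g x - \<psi> x))"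
    by (simp add: algebra_simps)
  also have "\<dots> \<le> L2_norm (\<lambda>x. f x - \<phi> x) + L2_norm (\<lambda>x. g x - \<psi> x)"
    using \<phi> \<psi> assms by (intro L2_norm_triangle square_integrable_diff)
      (auto simp: square_integrable approximable_square_integrable)
  also have "\<dots> < \<epsilon>" using \<phi> \<psi> by simp
  finally show "\<exists>h. approximable h \<and> L2_norm (\<lambda>x. (f x + g x) - h x) < \<epsilon>"
    using \<phi> \<psi> by (intro exI[of _ "\<lambda>x. \<phi> x + \<psi> x"] conjI approximable_R add)
qed (use assms approximable_square_integrable square_integrable_add in auto)

lemma approximable_diff:
  assumes "approximable f" "approximable g"
  shows "approximable (\<lambda>x. f x - g x)"
  using approximable_add[OF assms(1) approximable_scale[OF assms(2), of "-1"]] by simp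

text \<open>Some member of \<open>R\<close> is needed to be multiplied by 0; the Gaussian
  approximants of the unit box provide one.\<close>

lemma approximable_0: "approximable (\<lambda>x. 0)"
  using poly_gaussian_mult[OF _ polynomial_map.const[of 0]] box_gaussian_approximation[of 0 1]
    approximable_R[OF poly_gaussian] by auto

lemma approximable_box: "approximable (indicator (box a b))"
proof (cases "\<forall>k. a $ k < b $ k")
  case True
  then obtain f where f: "\<And>n. poly_gaussian (f n)" "(\<lambda>n. L2_norm (\<lambda>x. indicator (box a b) x
    - f n x)) \<longlonglongrightarrow> 0"
    using box_gaussian_approximation[of a b] by blast
  show ?thesis
  proof (rule approximable_limit[OF _ approximable_R[OF poly_gaussian[OF f(1)]] f(2)])
    show "square_integrable (indicator (box a b))"
      using emeasure_lborel_box_finite[of a b]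
        by (intro square_integrable_indicator) (auto simp: less_top)
  qed
next
  case False
  then have "box a b = {}" by (simp add: interval_eq_empty_cart not_less)
  then have "indicator (box a b) = (\<lambda>x :: real ^ 'd. 0 :: complex)" by auto
  then show ?thesis using approximable_0 by metis
qed

text \<open>Boxes are an intersection-stable generator, so induction over complements and disjoint
  unions applies. Intersecting with a fixed box keeps all measures finite: complements become
  differences, and the indicator of the box dominates the partial unions.\<close>

lemma approximable_borel_bounded:
  assumes "A \<in> sets borel"
  shows "approximable (indicator (A \<inter> box a b))"
proof -
  have "Int_stable (range (\<lambda>(a, b). box a b :: (real ^ 'd) set))"
    by (auto simp: Int_stable_def box_Int_box)
  moreover have "range (\<lambda>(a, b). box a b :: (real ^ 'd) set) \<subseteq> Pow UNIV" by auto
  moreover have "A \<in> sigma_sets UNIV (range (\<lambda>(a, b). box a b))"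
    using assms unfolding borel_eq_box by simp
  ultimately show ?thesis
  proof (induction rule: sigma_sets_induct_disjoint)
    case (basic A)
    then show ?case by (auto simp: box_Int_box approximable_box)
  next
    case empty
    then show ?case using approximable_0 by (simp add: indicator_def)
  next
    case (compl A)
    have "approximable (\<lambda>x. indicator (box a b) x - indicator (A \<inter> box a b) x)"
      using compl approximable_box by (intro approximable_diff)
    moreover have "indicator (box a b) x - indicator (A \<inter> box a b) x
      = (indicator ((UNIV - A) \<inter> box a b) x :: complex)" for x
      by (auto simp: indicator_def)
    ultimately show ?case by simp
  next
    case (union A)
    have A: "A i \<in> sets borel" for i using union by (auto simp: borel_eq_box)
    have meas: "B \<inter> box a b \<in> sets lebesgue" "emeasure lebesgue (B \<inter> box a b) < \<infinity>"
      if "B \<in> sets borel" for B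
    proof -
      show "B \<inter> box a b \<in> sets lebesgue" using that by auto
      have "emeasure lebesgue (B \<inter> box a b) \<le> emeasure lebesgue (box a b)"
        by (intro emeasure_mono) auto
      also have "\<dots> < \<infinity>" using emeasure_lborel_box_finite[of a b] by simp
      finally show "emeasure lebesgue (B \<inter> box a b) < \<infinity>" .
    qed
    have I: "approximable (\<lambda>x. \<Sum>i<n. indicator (A i \<inter> box a b) x)" for n
      by (induction n) (auto intro: approximable_0 approximable_add union)
    have eq: "(\<Sum>i<n. indicator (A i \<inter> box a b) x)
      = (indicator ((\<Union>i<n. A i) \<inter> box a b) x :: complex)" for n x
    proof -
      have "disjoint_family_on A {..<n}" using union.hyps(1)
        by (rule disjoint_family_on_mono[rotated]) simp
      then have "indicator (\<Union>i<n. A i) x = (\<Sum>i<n. indicator (A i) x :: complex)"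
        by (intro indicator_UN_disjoint) auto
      then show ?thesis by (simp add: indicator_inter_arith flip: sum_distrib_right)
    qed
    show ?case
    proof (rule approximable_limit)
      show "square_integrable (indicator ((\<Union>i. A i) \<inter> box a b))"
        using A by (intro square_integrable_indicator meas) auto
      show "approximable (indicator ((\<Union>i<n. A i) \<inter> box a b))" for n
        using I[of n] unfolding eq by simp
      show "(\<lambda>n. L2_norm (\<lambda>x. indicator ((\<Union>i. A i) \<inter> box a b) x
        - indicator ((\<Union>i<n. A i) \<inter> box a b) x)) \<longlonglongrightarrow> 0"
      proof (rule L2_norm_tendsto_0[where F = "indicator (box a b)"])
        show "integrable lebesgue (indicat_real (box a b))"
          by (rule integrable_indicator_box)
        show "(\<lambda>x. indicator ((\<Union>i. A i) \<inter> box a b) x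
          - indicator ((\<Union>i<n. A i) \<inter> box a b) x :: complex)
            \<in> borel_measurable lebesgue" for n
          using A by (intro borel_measurable_diff borel_measurable_indicator meas) auto
        show "AE x in lebesgue. (\<lambda>n. indicator ((\<Union>i. A i) \<inter> box a b) x
            - indicator ((\<Union>i<n. A i) \<inter> box a b) x :: complex) \<longlonglongrightarrow> 0"
        proof (rule AE_I2)
          fix x
          show "(\<lambda>n. indicator ((\<Union>i. A i) \<inter> box a b) x
            - indicator ((\<Union>i<n. A i) \<inter> box a b) x :: complex) \<longlonglongrightarrow> 0"
          proof (cases "x \<in> (\<Union>i. A i)")
            case True
            then obtain i where "x \<in> A i" by auto
            then have "\<forall>\<^sub>F n in sequentially. indicator ((\<Union>i. A i) \<inter> box a b) x
                - indicator ((\<Union>i<n. A i) \<inter> box a b) x = (0 :: complex)"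
              by (intro eventually_sequentiallyI[of "Suc i"]) (auto simp: indicator_def)
            then show ?thesis by (rule tendsto_eventually)
          qed (auto simp: indicator_def)
        qed
      qed (auto simp: indicator_def)
    qed
  qed
qed

text \<open>A Lebesgue set agrees almost everywhere with its Borel main part, which is exhausted by
  growing boxes; finite measure provides the majorant.\<close>

lemma approximable_indicator:
  assumes A: "A \<in> sets lebesgue" "emeasure lebesgue A < \<infinity>"
  shows "approximable (indicator A)"
proof -
  let ?A = "main_part lborel A"
  let ?B = "\<lambda>n::nat. box (- (real n *\<^sub>R One)) (real n *\<^sub>R One) :: (real ^ 'd) set"
  have A': "?A \<in> sets borel" using main_part_sets[OF A(1)] by simp
  have A'l: "?A \<in> sets lebesgue" using A' by simp
  have ae: "AE x in lebesgue. x \<in> ?A \<longleftrightarrow> x \<in> A"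
    using AE_in_main_part[OF A(1)] by (simp add: AE_completion)
  have fin: "emeasure lebesgue ?A < \<infinity>"
    using A A'l emeasure_eq_AE[OF ae] by simp
  have "approximable (indicator ?A)"
  proof (rule approximable_limit)
    show "square_integrable (indicator ?A)" using A'l fin by (rule square_integrable_indicator)
    show "approximable (indicator (?A \<inter> ?B n))" for n using A' by (rule approximable_borel_bounded)
    show "(\<lambda>n. L2_norm (\<lambda>x. indicator ?A x - indicator (?A \<inter> ?B n) x)) \<longlonglongrightarrow> 0"
    proof (rule L2_norm_tendsto_0[where F = "indicator ?A"])
      show "integrable lebesgue (indicat_real ?A)" using A'l fin
        by (simp add: integrable_indicator_iff)
      show "(\<lambda>x. indicator ?A x - indicator (?A \<inter> ?B n) x :: complex) \<in> borel_measurable lebesgue"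
        for n
        using A' by (intro borel_measurable_diff borel_measurable_indicator) auto
      show "AE x in lebesgue. (\<lambda>n. indicator ?A x - indicator (?A \<inter> ?B n) x :: complex) \<longlonglongrightarrow> 0"
      proof (rule AE_I2)
        fix x :: "real ^ 'd"
        obtain N where N: "x \<in> ?B N" using UN_box_eq_UNIV[where 'a = "real ^ 'd"] by blast
        have "x \<in> ?B n" if "N \<le> n" for n
          using N that by (auto simp: mem_box algebra_simps intro: le_less_trans less_le_trans)
        then have "\<forall>\<^sub>F n in sequentially. indicator ?A x - indicator (?A \<inter> ?B n) x = (0 :: complex)"
          by (intro eventually_sequentiallyI[of N]) (auto simp: indicator_def)
        then show "(\<lambda>n. indicator ?A x - indicator (?A \<inter> ?B n) x :: complex) \<longlonglongrightarrow> 0"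
          by (rule tendsto_eventually)
      qed
    qed (auto simp: indicator_def)
  qed
  then show ?thesis
    using A ae by (elim approximable_cong_AE)
      (auto simp: square_integrable_indicator indicator_def elim!: eventually_mono)
qed

text \<open>Induction over indicators, multiples, sums and increasing limits. Square integrability
  passes from a function to the pieces in the sum and limit cases because nonnegative pieces are
  dominated by the whole.\<close>

lemma approximable_nonneg:
  assumes "u \<in> borel_measurable lebesgue" "\<And>x. 0 \<le> u x"
    and "square_integrable (\<lambda>x. complex_of_real (u x))"
  shows "approximable (\<lambda>x. complex_of_real (u x))"
  using assms
proof (induction rule: borel_measurable_induct_real)
  case (set A)
  then have "integrable lebesgue (\<lambda>x. (norm (complex_of_real (indicator A x)))\<^sup>2)"
    by (simp add: square_integrable_def)
  also have "(\<lambda>x. (norm (complex_of_real (indicator A x)))\<^sup>2) = (indicator A :: _ \<Rightarrow> real)"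
    by (auto simp: indicator_def)
  finally have "emeasure lebesgue A < \<infinity>"
    using set by (simp add: integrable_indicator_iff)
  then show ?case using set approximable_indicator by (simp add: of_real_indicator)
next
  case (mult u c)
  show ?case
  \<comment> \<open>For \<open>c = 0\<close> the premise gives no information on u, so the induction
    hypothesis is not applicable.\<close>
  proof (cases "c = 0")
    case True
    then show ?thesis using approximable_0 by simp
  next
    case False
    have "square_integrable (\<lambda>x. complex_of_real (u x))"
      using square_integrable_scale[OF mult.prems, of "1 / complex_of_real c"] False by simp
    then show ?thesis using approximable_scale[OF mult.IH] by simp
  qed
next
  case (add u v)
  have "square_integrable (\<lambda>x. complex_of_real (u x))"
    "square_integrable (\<lambda>x. complex_of_real (v x))"
    using add square_integrable_norm[OF add.prems]
    by (auto intro!: square_integrable_bound[where F = "\<lambda>x. (norm (complex_of_real (v x + u x)))\<^sup>2"]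
        power_mono borel_measurable_of_real simp del: of_real_add simp: norm_of_real)
  then show ?case using approximable_add[OF add.IH(2,1)] by simp
next
  case (seq U)
  have U: "U n x \<le> u x" for n x using seq.hyps
    by (auto intro!: incseq_le simp: incseq_def le_fun_def)
  have u: "u \<in> borel_measurable lebesgue" using seq.hyps
    by (auto intro: borel_measurable_LIMSEQ_real[of lebesgue U])
  have n: "\<bar>U n x\<bar> \<le> u x" "\<bar>u x - U n x\<bar> \<le> \<bar>u x\<bar>" "0 \<le> u x" for n x
    using U[of n x] seq.hyps(2)[of n x] by auto
  show ?case
  proof (rule approximable_limit[OF seq.prems])
    show "approximable (\<lambda>x. complex_of_real (U n x))" for n
    proof (rule seq.IH)
      show "square_integrable (\<lambda>x. complex_of_real (U n x))"
        using U n(3) seq.hyps(2) seq.hyps(1)[of n]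
        by (intro square_integrable_bound[OF _ square_integrable_norm[OF seq.prems]])
          (auto intro!: power_mono borel_measurable_of_real)
    qed
    show "(\<lambda>n. L2_norm (\<lambda>x. complex_of_real (u x) - complex_of_real (U n x))) \<longlonglongrightarrow> 0"
    proof (rule L2_norm_tendsto_0[OF square_integrable_norm[OF seq.prems]])
      show "(\<lambda>x. complex_of_real (u x) - complex_of_real (U n x)) \<in> borel_measurable lebesgue" for n
        using u seq.hyps(1)[of n] by (intro borel_measurable_diff) auto
      show "(norm (complex_of_real (u x) - complex_of_real (U n x)))\<^sup>2
        \<le> (norm (complex_of_real (u x)))\<^sup>2" for n x
        using n(2)[of x n] unfolding of_real_diff[symmetric] norm_of_real by (intro power_mono) auto
      show "AE x in lebesgue. (\<lambda>n. complex_of_real (u x) - complex_of_real (U n x)) \<longlonglongrightarrow> 0"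
        using seq.hyps(4) by (auto intro!: AE_I2 tendsto_eq_intros)
    qed
  qed
qed

lemma approximable_real:
  assumes "square_integrable (\<lambda>x. complex_of_real (u x))"
  shows "approximable (\<lambda>x. complex_of_real (u x))"
proof -
  have "(\<lambda>x. Re (complex_of_real (u x))) \<in> borel_measurable lebesgue"
    using assms by (intro measurable_compose[OF _ borel_measurable_Re])
      (simp add: square_integrable_def)
  then have u: "u \<in> borel_measurable lebesgue" by simp
  \<comment> \<open>The signs \<open>s = 1\<close> and \<open>s = - 1\<close> give the positive and
    the negative part of u.\<close>
  have p: "approximable (\<lambda>x. complex_of_real (max 0 (s * u x)))" if "\<bar>s\<bar> = 1" for s
  proof (rule approximable_nonneg)
    show 1: "(\<lambda>x. max 0 (s * u x)) \<in> borel_measurable lebesgue" using u by measurable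
    show "square_integrable (\<lambda>x. complex_of_real (max 0 (s * u x)))"
    proof (rule square_integrable_bound[OF _ square_integrable_norm[OF assms]])
      show "(\<lambda>x. complex_of_real (max 0 (s * u x))) \<in> borel_measurable lebesgue"
        using 1 by auto
      show "(norm (complex_of_real (max 0 (s * u x))))\<^sup>2 \<le> (norm (complex_of_real (u x)))\<^sup>2" for x
        using that abs_mult[of s "u x"] by (intro power_mono) auto
    qed
  qed auto
  have "approximable (\<lambda>x. complex_of_real (max 0 (1 * u x)) - complex_of_real (max 0 (- 1 * u x)))"
    by (intro approximable_diff p) auto
  moreover have "complex_of_real (max 0 (1 * u x)) - complex_of_real (max 0 (- 1 * u x))
    = complex_of_real (u x)" for x
    by (simp add: max_def)
  ultimately show ?thesis by simp
qed

theorem L2_dense: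
  assumes f: "square_integrable f"
  shows "approximable f"
proof -
  have b: "f \<in> borel_measurable lebesgue" using f by (simp add: square_integrable_def)
  have "square_integrable (\<lambda>x. complex_of_real (Re (f x)))"
    "square_integrable (\<lambda>x. complex_of_real (Im (f x)))"
    using b measurable_compose[OF b borel_measurable_Re] measurable_compose[OF b
      borel_measurable_Im]
    by (auto intro!: square_integrable_bound[OF _ square_integrable_norm[OF f]] power_mono
        simp: abs_Re_le_cmod abs_Im_le_cmod simp flip: power2_abs)
  then have "approximable (\<lambda>x. complex_of_real (Re (f x)) + \<i> * complex_of_real (Im (f x)))"
    by (intro approximable_add approximable_scale approximable_real)
  then show ?thesis by (simp add: complex_eq[symmetric])
qed

end

section \<open>Strong continuity of the Weyl groups\<close>

text \<open>The infinitesimal generator of the group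
  \<open>t \<mapsto> weyl (t *\<^sub>R p)\<close>, as shown in
  \<open>weyl_has_vector_derivative\<close>.\<close>

definition weyl_gen :: "(real ^ 'd) \<times> (real ^ 'd) \<Rightarrow> (real ^ 'd \<Rightarrow> complex) \<Rightarrow> real ^ 'd \<Rightarrow> complex"
  where
  "weyl_gen p \<phi> = (\<lambda>x. (\<Sum>k\<in>UNIV. complex_of_real (fst p $ k) * partial_deriv k \<phi> x)
     + 2 * pi * \<i> * complex_of_real (snd p \<bullet> x) * \<phi> x)"

text \<open>Summands may have different exponents, so their sum need not be
  \<open>poly_gaussian\<close>; only the bound with the smaller decay rate is kept.\<close>

lemma poly_gaussian_sum_bound:
  assumes "\<And>i. i \<in> I \<Longrightarrow> poly_gaussian (f i)"
  shows "\<exists>C \<epsilon>. \<epsilon> > 0 \<and> C \<ge> 0 \<and> (\<forall>x. norm (\<Sum>i\<in>I. f i x) \<le> C * exp (- \<epsilon> * (norm x)\<^sup>2))"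
  using assms
proof (induction I rule: infinite_finite_induct)
  case (insert i I)
  obtain C \<epsilon> where 1: "\<epsilon> > 0" "C \<ge> 0" "\<And>x. norm (\<Sum>i\<in>I. f i x) \<le> C * exp (- \<epsilon> * (norm x)\<^sup>2)"
    using insert by auto
  obtain D \<delta> where 2: "\<delta> > 0" "D \<ge> 0" "\<And>x. norm (f i x) \<le> D * exp (- \<delta> * (norm x)\<^sup>2)"
    using insert poly_gaussian_bound by blast
  have "norm (\<Sum>i\<in>insert i I. f i x) \<le> (C + D) * exp (- min \<epsilon> \<delta> * (norm x)\<^sup>2)" for x
  proof -
    have "norm (\<Sum>i\<in>insert i I. f i x) \<le> norm (f i x) + norm (\<Sum>i\<in>I. f i x)"
      using insert.hyps by (simp add: norm_triangle_ineq)
    also have "\<dots> \<le> D * exp (- \<delta> * (norm x)\<^sup>2) + C * exp (- \<epsilon> * (norm x)\<^sup>2)"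
      using 1(3) 2(3) by (intro add_mono)
    also have "\<dots> \<le> D * exp (- min \<epsilon> \<delta> * (norm x)\<^sup>2) + C * exp (- min \<epsilon> \<delta> * (norm x)\<^sup>2)"
      using 1(2) 2(2) by (intro add_mono mult_left_mono) (auto intro!: mult_right_mono)
    finally show ?thesis by (simp add: algebra_simps)
  qed
  then show ?case using 1 2 by (intro exI[of _ "C + D"] exI[of _ "min \<epsilon> \<delta>"]) auto
qed (auto intro!: exI[of _ 0] exI[of _ 1])

lemma weyl_gen_bound:
  assumes "poly_gaussian \<phi>"
  shows "\<exists>C \<epsilon>. \<epsilon> > 0 \<and> C \<ge> 0 \<and> (\<forall>x. norm (weyl_gen p \<phi> x) \<le> C * exp (- \<epsilon> * (norm x)\<^sup>2))"
proof -
  \<comment> \<open>\<open>None\<close> indexes the multiplication term and \<open>Some k\<close>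
    the k-th derivative term, so that the generator becomes a single finite sum.\<close>
  let ?f = "case_option (\<lambda>x. complex_of_real (((2 * pi) *\<^sub>R snd p) \<bullet> x) * (\<i> * \<phi> x))
    (\<lambda>k x. complex_of_real (fst p $ k) * partial_deriv k \<phi> x)"
  have "weyl_gen p \<phi> = (\<lambda>x. \<Sum>i\<in>UNIV. ?f i x)"
    by (rule ext) (simp add: weyl_gen_def UNIV_option_conv sum.reindex mult_ac)
  moreover have "poly_gaussian (?f i)" for i
    using assms by (cases i)
      (auto intro!: poly_gaussian_mult poly_gaussian_deriv polynomial_map.const polynomial_map_inner
        simp del: inner_scaleR_left)
  ultimately show ?thesis
    using poly_gaussian_sum_bound[of UNIV ?f] by simp
qed

lemma has_vector_derivative_exp_i:
  assumes "(\<theta> has_real_derivative D) (at t)"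
  shows "((\<lambda>t. exp (\<i> * complex_of_real (\<theta> t))) has_vector_derivative
    exp (\<i> * complex_of_real (\<theta> t)) * (\<i> * complex_of_real D)) (at t)"
proof -
  have "((\<lambda>t. \<i> * complex_of_real (\<theta> t)) has_vector_derivative \<i> * complex_of_real D) (at t)"
    using assms by (intro has_vector_derivative_mult_right has_vector_derivative_of_real)
  from field_vector_diff_chain_at[OF this DERIV_exp] show ?thesis by (simp add: o_def mult.commute)
qed

text \<open>For \<open>p = (m, n)\<close> the phase is quadratic in t, and its derivative
  \<open>2 * pi * (t * (m \<bullet> n) + n \<bullet> x)\<close> is
  \<open>2 * pi * (n \<bullet> (x + t *\<^sub>R m))\<close>: the multiplication term of the
  generator, evaluated at the translated point.\<close>

lemma weyl_has_vector_derivative: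
  assumes "poly_gaussian \<phi>"
  shows "((\<lambda>t. weyl (t *\<^sub>R p) \<phi> x) has_vector_derivative weyl (t *\<^sub>R p) (weyl_gen p \<phi>) x) (at t)"
proof -
  let ?m = "fst p" and ?n = "snd p"
  let ?\<theta> = "\<lambda>t. pi * (t\<^sup>2 * (?m \<bullet> ?n)) + 2 * pi * (t * (?n \<bullet> x))"
  let ?c = "\<lambda>t. exp (\<i> * complex_of_real (?\<theta> t))"
  let ?D = "frechet_derivative \<phi> (at (x + t *\<^sub>R ?m))"
  have eq: "weyl (t *\<^sub>R p) f x = ?c t * f (x + t *\<^sub>R ?m)" for t f
    by (simp add: weyl_def cis_conv_exp power2_eq_square mult_ac)
  have d: "\<phi> differentiable (at (x + t *\<^sub>R ?m))" using poly_gaussian_deriv(1)[OF assms] .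
  have "((\<lambda>t. x + t *\<^sub>R ?m) has_vector_derivative ?m) (at t)"
    by (auto intro!: derivative_eq_intros)
  moreover have "(\<phi> has_derivative ?D) (at (x + t *\<^sub>R ?m) within range (\<lambda>t. x + t *\<^sub>R ?m))"
    using d unfolding frechet_derivative_works by (rule has_derivative_at_withinI)
  ultimately have 1: "((\<lambda>t. \<phi> (x + t *\<^sub>R ?m)) has_vector_derivative ?D ?m) (at t)"
    using vector_derivative_diff_chain_within[of "\<lambda>t. x + t *\<^sub>R ?m" ?m t UNIV \<phi> ?D]
      by (simp add: o_def)
  have "(?\<theta> has_real_derivative 2 * pi * (t * (?m \<bullet> ?n) + ?n \<bullet> x)) (at t)"
    by (auto intro!: derivative_eq_intros simp: algebra_simps)
  then have 2: "(?c has_vector_derivative ?c t * (\<i> * complex_of_real (2 * pi * (t * (?m \<bullet> ?n)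
    + ?n \<bullet> x)))) (at t)"
    by (rule has_vector_derivative_exp_i)
  have "((\<lambda>t. ?c t * \<phi> (x + t *\<^sub>R ?m)) has_vector_derivative
      ?c t * ?D ?m + ?c t * (\<i> * complex_of_real (2 * pi * (t * (?m \<bullet> ?n) + ?n \<bullet> x))) * \<phi> (x
        + t *\<^sub>R ?m)) (at t)"
    using has_vector_derivative_mult[OF 2 1] by simp
  moreover have "?c t * ?D ?m + ?c t * (\<i> * complex_of_real (2 * pi * (t * (?m \<bullet> ?n)
    + ?n \<bullet> x))) * \<phi> (x + t *\<^sub>R ?m)
      = ?c t * weyl_gen p \<phi> (x + t *\<^sub>R ?m)"
    unfolding weyl_gen_def frechet_derivative_eq_partial_deriv[OF d, symmetric]
    by (simp add: inner_add_right inner_commute[of ?n ?m] algebra_simps)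
  ultimately show ?thesis unfolding eq by simp
qed

text \<open>Mean value inequality with a Gaussian majorant of the derivative, uniform in
  \<open>\<bar>t\<bar> \<le> 1\<close>. F yields norm continuity and later dominates difference
  quotients under the integral.\<close>

lemma weyl_increment_bound:
  assumes "poly_gaussian \<phi>"
  shows "\<exists>F. (\<forall>x. 0 \<le> F x) \<and> square_integrable (\<lambda>x. complex_of_real (F x)) \<and>
    (\<forall>t x. \<bar>t\<bar> \<le> 1 \<longrightarrow> norm (weyl (t *\<^sub>R p) \<phi> x - \<phi> x) \<le> \<bar>t\<bar> * F x)"
proof -
  obtain C \<epsilon> where C: "\<epsilon> > 0" "C \<ge> 0" "\<And>x. norm (weyl_gen p \<phi> x) \<le> C * exp (- \<epsilon> * (norm x)\<^sup>2)"
    using weyl_gen_bound[OF assms] by blast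
  \<comment> \<open>The factor \<open>exp (\<epsilon> * (norm (fst p))\<^sup>2)\<close> and the
    halved rate absorb all shifts by \<open>s *\<^sub>R fst p\<close> with
    \<open>\<bar>s\<bar> \<le> 1\<close>.\<close>
  define F where "F = (\<lambda>x :: real ^ 'a. C * exp (\<epsilon> * (norm (fst p))\<^sup>2) * exp (- (\<epsilon> / 2) * (norm
    x)\<^sup>2))"
  have "square_integrable (\<lambda>x. complex_of_real (F x))"
  proof (rule square_integrable_gaussian_bound[of _ "\<epsilon> / 2" "C * exp (\<epsilon> * (norm (fst p))\<^sup>2)"])
    show "(\<lambda>x. complex_of_real (F x)) \<in> borel_measurable lebesgue"
      unfolding F_def by (intro measurable_completion)
        (auto intro!: borel_measurable_continuous_onI continuous_intros)
  qed (use C in \<open>auto simp: F_def norm_mult\<close>)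
  moreover have "norm (weyl (t *\<^sub>R p) \<phi> x - \<phi> x) \<le> \<bar>t\<bar> * F x" if t: "\<bar>t\<bar> \<le> 1" for t x
  proof -
    have "norm (weyl (t *\<^sub>R p) \<phi> x - weyl (0 *\<^sub>R p) \<phi> x) \<le> F x * norm (t - 0)"
    proof (rule differentiable_bound[where S = "{-1..1}"])
      fix s :: real assume s: "s \<in> {-1..1}"
      show "((\<lambda>t. weyl (t *\<^sub>R p) \<phi> x) has_derivative (\<lambda>h. h *\<^sub>R weyl (s *\<^sub>R p) (weyl_gen p \<phi>) x))
        (at s within {-1..1})"
        using has_vector_derivative_at_within[OF weyl_has_vector_derivative[OF assms]]
        by (simp add: has_vector_derivative_def)
      have "norm (weyl (s *\<^sub>R p) (weyl_gen p \<phi>) x) = norm (weyl_gen p \<phi> (x + s *\<^sub>R fst p))"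
        by (simp add: weyl_def norm_mult)
      also have "\<dots> \<le> C * exp (- \<epsilon> * (norm (x + s *\<^sub>R fst p))\<^sup>2)" by (rule C)
      also have "\<dots> \<le> C * exp (\<epsilon> * (norm (fst p))\<^sup>2 + - (\<epsilon> / 2) * (norm x)\<^sup>2)"
      proof -
        have "(norm (s *\<^sub>R fst p))\<^sup>2 \<le> (norm (fst p))\<^sup>2"
          using s mult_right_mono[of "\<bar>s\<bar>" 1 "norm (fst p)"] by (intro power_mono) auto
        then have "(norm x)\<^sup>2 / 2 - (norm (fst p))\<^sup>2 \<le> (norm (x + s *\<^sub>R fst p))\<^sup>2"
          using norm_shift_square[of x "s *\<^sub>R fst p"] by linarith
        then have "\<epsilon> * ((norm x)\<^sup>2 / 2 - (norm (fst p))\<^sup>2) \<le> \<epsilon> * (norm (x + s *\<^sub>R fst p))\<^sup>2"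
          using C(1) by (intro mult_left_mono) auto
        then show ?thesis using C(2) by (intro mult_left_mono) (auto simp: algebra_simps)
      qed
      also have "\<dots> = F x" by (simp only: F_def exp_add mult.assoc)
      finally have "norm (weyl (s *\<^sub>R p) (weyl_gen p \<phi>) x) \<le> F x" .
      then show "onorm (\<lambda>h. h *\<^sub>R weyl (s *\<^sub>R p) (weyl_gen p \<phi>) x) \<le> F x"
        by (intro onorm_le) (simp add: mult.commute[of "F x"] mult_left_mono)
    qed (use t in auto)
    then show ?thesis by (simp add: weyl_0 mult.commute)
  qed
  moreover have "\<forall>x. 0 \<le> F x" using C by (simp add: F_def)
  ultimately show ?thesis by blast
qed

lemma L2_norm_mono:
  assumes "square_integrable f" "square_integrable g" "\<And>x. norm (f x) \<le> norm (g x)"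
  shows "L2_norm f \<le> L2_norm g"
  unfolding L2_norm_def using assms
  by (intro real_sqrt_le_mono integral_mono square_integrable_norm power_mono) auto

lemma weyl_continuous_poly_gaussian:
  assumes "poly_gaussian \<phi>"
  shows "((\<lambda>t. L2_norm (\<lambda>x. weyl (t *\<^sub>R p) \<phi> x - \<phi> x)) \<longlongrightarrow> 0) (at 0)"
proof -
  obtain F where F: "\<forall>x. 0 \<le> F x" "square_integrable (\<lambda>x. complex_of_real (F x))"
    "\<forall>t x. \<bar>t\<bar> \<le> 1 \<longrightarrow> norm (weyl (t *\<^sub>R p) \<phi> x - \<phi> x) \<le> \<bar>t\<bar> * F x"
    using weyl_increment_bound[OF assms] by blast
  let ?K = "L2_norm (\<lambda>x. complex_of_real (F x))"
  have "L2_norm (\<lambda>x. weyl (t *\<^sub>R p) \<phi> x - \<phi> x) \<le> \<bar>t\<bar> * ?K" if "\<bar>t\<bar> \<le> 1" for t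
  proof -
    have "L2_norm (\<lambda>x. weyl (t *\<^sub>R p) \<phi> x - \<phi> x)
      \<le> L2_norm (\<lambda>x. complex_of_real \<bar>t\<bar> * complex_of_real (F x))"
      using F that square_integrable_poly_gaussian[OF assms]
      by (intro L2_norm_mono square_integrable_diff square_integrable_scale square_integrable_weyl)
        (auto simp: norm_mult)
    then show ?thesis by (simp add: L2_norm_scale)
  qed
  then have "\<forall>\<^sub>F t in at 0. norm (L2_norm (\<lambda>x. weyl (t *\<^sub>R p) \<phi> x - \<phi> x)) \<le> \<bar>t\<bar> * ?K"
    unfolding eventually_at by (intro exI[of _ 1]) (auto simp: L2_norm_nonneg)
  moreover have "((\<lambda>t. \<bar>t\<bar> * ?K) \<longlongrightarrow> 0) (at 0)" by (auto intro!: tendsto_eq_intros)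
  ultimately show ?thesis by (rule Lim_null_comparison)
qed

theorem weyl_strongly_continuous:
  assumes f: "square_integrable f"
  shows "((\<lambda>t. L2_norm (\<lambda>x. weyl (t *\<^sub>R p) f x - f x)) \<longlongrightarrow> 0) (at 0)"
proof -
  define R where "R = (\<lambda>f. square_integrable f
    \<and> ((\<lambda>t. L2_norm (\<lambda>x. weyl (t *\<^sub>R p) f x - f x)) \<longlongrightarrow> 0) (at 0))"
  interpret L2_test_space R
  proof
    fix f g and c :: complex
    show "poly_gaussian f \<Longrightarrow> R f"
      by (simp add: R_def weyl_continuous_poly_gaussian square_integrable_poly_gaussian)
    show "R f \<Longrightarrow> square_integrable f" by (simp add: R_def)
    show "R (\<lambda>x. c * f x)" if "R f"
    proof -
      have "L2_norm (\<lambda>x. weyl (t *\<^sub>R p) (\<lambda>x. c * f x) x - c * f x)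
        = norm c * L2_norm (\<lambda>x. weyl (t *\<^sub>R p) f x - f x)" for t
        by (simp add: weyl_scale L2_norm_scale flip: right_diff_distrib)
      then show ?thesis
        using that by (auto simp: R_def square_integrable_scale intro!: tendsto_mult_right_zero)
    qed
    show "R (\<lambda>x. f x + g x)" if "R f" "R g"
    proof -
      have "L2_norm (\<lambda>x. weyl (t *\<^sub>R p) (\<lambda>x. f x + g x) x - (f x + g x))
          \<le> L2_norm (\<lambda>x. weyl (t *\<^sub>R p) f x - f x) + L2_norm (\<lambda>x. weyl (t *\<^sub>R p) g x - g x)" for t
        using that L2_norm_triangle[of "\<lambda>x. weyl (t *\<^sub>R p) f x - f x" "\<lambda>x. weyl (t *\<^sub>R p) g x
          - g x"]
        by (simp add: R_def weyl_add square_integrable_diff square_integrable_weyl algebra_simps)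
      moreover have "((\<lambda>t. L2_norm (\<lambda>x. weyl (t *\<^sub>R p) f x - f x) + L2_norm (\<lambda>x. weyl (t *\<^sub>R p) g x
        - g x)) \<longlongrightarrow> 0) (at 0)"
        using that unfolding R_def by (intro tendsto_add_zero) auto
      ultimately have "((\<lambda>t. L2_norm (\<lambda>x. weyl (t *\<^sub>R p) (\<lambda>x. f x + g x) x - (f x + g x)))
        \<longlongrightarrow> 0) (at 0)"
        by (intro Lim_null_comparison[where f
          = "\<lambda>t. L2_norm (\<lambda>x. weyl (t *\<^sub>R p) (\<lambda>x. f x + g x) x - (f x + g x))"])
          (auto simp: L2_norm_nonneg)
      then show ?thesis using that by (simp add: R_def square_integrable_add)
    qed
  qed
  show ?thesis
  proof (rule tendstoI)
    fix \<epsilon> :: real assume "\<epsilon> > 0"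
    then have \<epsilon>: "\<epsilon> / 3 > 0" by simp
    then obtain \<phi> where \<phi>: "R \<phi>" "L2_norm (\<lambda>x. f x - \<phi> x) < \<epsilon> / 3"
      using L2_dense[OF f] unfolding approximable_def by blast
    have \<phi>s: "square_integrable \<phi>" using \<phi> square_integrable by blast
    have "\<forall>\<^sub>F t in at 0. L2_norm (\<lambda>x. weyl (t *\<^sub>R p) \<phi> x - \<phi> x) < \<epsilon> / 3"
      using \<phi>(1) order_tendstoD(2)[OF _ \<epsilon>] unfolding R_def by blast
    then show "\<forall>\<^sub>F t in at 0. dist (L2_norm (\<lambda>x. weyl (t *\<^sub>R p) f x - f x)) 0 < \<epsilon>"
    proof eventually_elim
      case (elim t)
      have "L2_norm (\<lambda>x. weyl (t *\<^sub>R p) f x - f x)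
          \<le> L2_norm (\<lambda>x. weyl (t *\<^sub>R p) f x - weyl (t *\<^sub>R p) \<phi> x) + L2_norm (\<lambda>x. weyl (t *\<^sub>R p) \<phi> x
            - f x)"
        using f \<phi>s by (intro L2_norm_triangle_diff square_integrable_weyl)
      also have "\<dots> \<le> L2_norm (\<lambda>x. weyl (t *\<^sub>R p) f x - weyl (t *\<^sub>R p) \<phi> x)
          + (L2_norm (\<lambda>x. weyl (t *\<^sub>R p) \<phi> x - \<phi> x) + L2_norm (\<lambda>x. \<phi> x - f x))"
        using f \<phi>s by (intro add_left_mono L2_norm_triangle_diff square_integrable_weyl)
      \<comment> \<open>Unitarity makes this approximation error independent of t.\<close>
      also have "L2_norm (\<lambda>x. weyl (t *\<^sub>R p) f x - weyl (t *\<^sub>R p) \<phi> x) = L2_norm (\<lambda>x. f x - \<phi> x)"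
        using f \<phi>s by (simp add: L2_norm_weyl square_integrable_diff flip: weyl_diff)
      finally show ?case
        using elim \<phi>(2) L2_norm_minus_commute[of \<phi> f] by (simp add: L2_norm_nonneg dist_norm)
    qed
  qed
qed

section \<open>Weak derivatives as generators\<close>

lemma has_vector_derivative_iff_quotient:
  fixes f :: "real \<Rightarrow> complex"
  shows "(f has_vector_derivative D) (at t) \<longleftrightarrow> ((\<lambda>h. (f (t + h) - f t) / complex_of_real h)
    \<longlongrightarrow> D) (at 0)"
proof -
  have *: "norm (f (t + h) - f t - h *\<^sub>R D) / norm h
    = norm ((f (t + h) - f t) / complex_of_real h - D)" if "h \<noteq> 0" for h
  proof -
    have "(f (t + h) - f t) / complex_of_real h - D
      = (f (t + h) - f t - h *\<^sub>R D) / complex_of_real h"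
      using that by (simp add: scaleR_conv_of_real diff_divide_distrib)
    then show ?thesis by (simp add: norm_divide)
  qed
  have "(f has_vector_derivative D) (at t) \<longleftrightarrow> ((\<lambda>h. norm (f (t + h) - f t - h *\<^sub>R D) / norm h)
    \<longlongrightarrow> 0) (at 0)"
    by (simp add: has_vector_derivative_def has_derivative_at bounded_linear_scaleR_left)
  also have "\<dots> \<longleftrightarrow> ((\<lambda>h. norm ((f (t + h) - f t) / complex_of_real h - D)) \<longlongrightarrow> 0) (at 0)"
    by (intro Lim_cong_within) (auto simp: * simp del: real_norm_def)
  also have "\<dots> \<longleftrightarrow> ((\<lambda>h. (f (t + h) - f t) / complex_of_real h) \<longlongrightarrow> D) (at 0)"
    by (simp add: tendsto_norm_zero_iff LIM_zero_iff)
  finally show ?thesis .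
qed

section \<open>The bilinear pairing with test functions\<close>

lemma dist_of_eq_L2_inner: "dist_of f \<phi> = L2_inner f (\<lambda>x. cnj (\<phi> x))"
  by (simp add: dist_of_def L2_inner_def)

lemma L2_norm_cnj: "L2_norm (\<lambda>x. cnj (f x)) = L2_norm f"
  by (simp add: L2_norm_def)

lemma dist_of_bound:
  assumes "square_integrable f" "square_integrable \<phi>"
  shows "norm (dist_of f \<phi>) \<le> L2_norm f * L2_norm \<phi>"
  using L2_Cauchy_Schwarz[OF assms(1) square_integrable_cnj[OF assms(2)]]
  by (simp add: dist_of_eq_L2_inner L2_norm_cnj)

lemma dist_of_add_right:
  assumes "square_integrable f" "square_integrable \<phi>" "square_integrable \<psi>"
  shows "dist_of f (\<lambda>x. \<phi> x + \<psi> x) = dist_of f \<phi> + dist_of f \<psi>"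
  using assms by (simp add: dist_of_eq_L2_inner L2_inner_add_right square_integrable_cnj)

lemma dist_of_scale_right: "dist_of f (\<lambda>x. c * \<phi> x) = c * dist_of f \<phi>"
  by (simp add: dist_of_eq_L2_inner L2_inner_scale_right)

lemma dist_of_add_left:
  assumes "square_integrable f" "square_integrable g" "square_integrable \<phi>"
  shows "dist_of (\<lambda>x. f x + g x) \<phi> = dist_of f \<phi> + dist_of g \<phi>"
  using assms by (simp add: dist_of_eq_L2_inner L2_inner_add_left square_integrable_cnj)

lemma dist_of_diff_left:
  assumes "square_integrable f" "square_integrable g" "square_integrable \<phi>"
  shows "dist_of (\<lambda>x. f x - g x) \<phi> = dist_of f \<phi> - dist_of g \<phi>"
  using assms by (simp add: dist_of_eq_L2_inner L2_inner_diff_left square_integrable_cnj)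

lemma dist_of_scale_left: "dist_of (\<lambda>x. c * f x) \<phi> = c * dist_of f \<phi>"
  by (simp add: dist_of_eq_L2_inner L2_inner_scale_left)

lemma dist_of_sum_right:
  assumes "square_integrable f" "\<And>i. i \<in> I \<Longrightarrow> square_integrable (\<phi> i)"
  shows "dist_of f (\<lambda>x. \<Sum>i\<in>I. c i * \<phi> i x) = (\<Sum>i\<in>I. c i * dist_of f (\<phi> i))"
  using L2_inner_sum_right[of I "\<lambda>i x. cnj (\<phi> i x)" f "\<lambda>i. cnj (c i)"] assms
  by (simp add: dist_of_eq_L2_inner square_integrable_cnj)

lemma square_integrable_weyl_gen:
  assumes "poly_gaussian \<phi>"
  shows "square_integrable (\<lambda>x. complex_of_real (n \<bullet> x) * \<phi> x)"
    and "square_integrable (partial_deriv k \<phi>)"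
    and "square_integrable (weyl_gen p \<phi>)"
proof -
  show 1: "square_integrable (\<lambda>x. complex_of_real (n \<bullet> x) * \<phi> x)" for n
    by (intro square_integrable_poly_gaussian poly_gaussian_mult polynomial_map_inner assms)
  show 2: "square_integrable (partial_deriv k \<phi>)" for k
    by (intro square_integrable_poly_gaussian poly_gaussian_deriv assms)
  show "square_integrable (weyl_gen p \<phi>)"
    unfolding weyl_gen_def mult.assoc
    by (intro square_integrable_add square_integrable_sum square_integrable_scale 1 2)
qed

text \<open>Differentiation under the integral: the difference quotients converge pointwise and are
  dominated by the F of \<open>weyl_increment_bound\<close>, whose product with f is
  integrable.\<close>

lemma dist_of_weyl_derivative_0:
  assumes f: "square_integrable f" and \<phi>: "poly_gaussian \<phi>"
  shows "((\<lambda>t. dist_of f (weyl (t *\<^sub>R p) \<phi>)) has_vector_derivative dist_of f (weyl_gen p \<phi>)) (at 0)"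
proof -
  obtain F where F: "\<And>x. 0 \<le> F x" "square_integrable (\<lambda>x. complex_of_real (F x))"
    "\<And>t x. \<bar>t\<bar> \<le> 1 \<Longrightarrow> norm (weyl (t *\<^sub>R p) \<phi> x - \<phi> x) \<le> \<bar>t\<bar> * F x"
    using weyl_increment_bound[OF \<phi>] by blast
  let ?q = "\<lambda>t x. (weyl (t *\<^sub>R p) \<phi> x - \<phi> x) / complex_of_real t"
  have sq: "square_integrable (weyl (t *\<^sub>R p) \<phi>)" "square_integrable \<phi>" for t
    using \<phi> square_integrable_weyl square_integrable_poly_gaussian by blast+
  have sqq: "square_integrable (?q t)" for t
    using square_integrable_scale[OF square_integrable_diff[OF sq], of "1 / complex_of_real t"]
      by simp
  have bm: "f \<in> borel_measurable lebesgue" "?q t \<in> borel_measurable lebesgue"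
    "weyl_gen p \<phi> \<in> borel_measurable lebesgue" for t
    using f sqq[of t] square_integrable_weyl_gen(3)[OF \<phi>, of p]
      by (auto simp: square_integrable_def)
  \<comment> \<open>The majorant is available for \<open>\<bar>s n\<bar> \<le> 1\<close> only; other
    null sequences are reduced to this case by dropping finitely many terms.\<close>
  have lim: "(\<lambda>n. dist_of f (?q (s n))) \<longlonglongrightarrow> dist_of f (weyl_gen p \<phi>)"
    if s: "\<And>n. s n \<noteq> 0" "\<And>n. \<bar>s n\<bar> \<le> 1" "s \<longlonglongrightarrow> 0" for s
    unfolding dist_of_def
  proof (rule integral_dominated_convergence[where w = "\<lambda>x. norm (f x * complex_of_real (F x))"])
    show "integrable lebesgue (\<lambda>x. norm (f x * complex_of_real (F x)))"
      using integrable_L2_mult[OF f F(2)] by (rule integrable_norm)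
    show "AE x in lebesgue. norm (f x * ?q (s n) x) \<le> norm (f x * complex_of_real (F x))" for n
    proof (rule AE_I2)
      fix x
      have "norm (?q (s n) x) \<le> F x"
        using F(3)[OF s(2)[of n], of x] s(1)[of n] by (simp add: norm_divide field_simps)
      then show "norm (f x * ?q (s n) x) \<le> norm (f x * complex_of_real (F x))"
        unfolding norm_mult using F(1) by (intro mult_left_mono) auto
    qed
    show "AE x in lebesgue. (\<lambda>n. f x * ?q (s n) x) \<longlonglongrightarrow> f x * weyl_gen p \<phi> x"
    proof (rule AE_I2)
      fix x
      have "((\<lambda>h. ?q h x) \<longlongrightarrow> weyl_gen p \<phi> x) (at 0)"
        using weyl_has_vector_derivative[OF \<phi>, of p x 0]
        unfolding has_vector_derivative_iff_quotient by (simp add: weyl_0)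
      then have "(\<lambda>n. ?q (s n) x) \<longlonglongrightarrow> weyl_gen p \<phi> x"
        using s by (auto simp: tendsto_at_iff_sequentially o_def)
      then show "(\<lambda>n. f x * ?q (s n) x) \<longlonglongrightarrow> f x * weyl_gen p \<phi> x" by (rule tendsto_mult_left)
    qed
  qed (rule borel_measurable_times bm)+
  have "((\<lambda>t. dist_of f (?q t)) \<longlongrightarrow> dist_of f (weyl_gen p \<phi>)) (at 0)"
    unfolding tendsto_at_iff_sequentially o_def
  proof (intro allI impI)
    fix s :: "nat \<Rightarrow> real" assume s: "\<forall>i. s i \<in> UNIV - {0}" "s \<longlonglongrightarrow> 0"
    then have "\<forall>\<^sub>F n in sequentially. \<bar>s n\<bar> < 1"
      using order_tendstoD(2)[OF tendsto_rabs_zero[OF s(2)], of 1] by simp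
    then obtain N where N: "\<And>n. n \<ge> N \<Longrightarrow> \<bar>s n\<bar> \<le> 1"
      unfolding eventually_sequentially by (meson less_imp_le)
    show "(\<lambda>n. dist_of f (?q (s n))) \<longlonglongrightarrow> dist_of f (weyl_gen p \<phi>)"
      by (rule LIMSEQ_offset[of _ N], rule lim)
        (use s N LIMSEQ_ignore_initial_segment[OF s(2)] in auto)
  qed
  moreover have "dist_of f (?q t)
    = (dist_of f (weyl (t *\<^sub>R p) \<phi>) - dist_of f \<phi>) / complex_of_real t" for t
    using dist_of_scale_right[of f "1 / complex_of_real t" "\<lambda>x. weyl (t *\<^sub>R p) \<phi> x - \<phi> x"]
      dist_of_add_right[OF f sq(1) square_integrable_scale[OF sq(2), of "-1"], of t]
      dist_of_scale_right[of f "-1" \<phi>] by simp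
  ultimately show ?thesis
    unfolding has_vector_derivative_iff_quotient by (simp add: weyl_0)
qed

lemma weyl_scaleR_add: "weyl ((s + t) *\<^sub>R p) f = weyl (s *\<^sub>R p) (weyl (t *\<^sub>R p) f)"
  by (simp add: weyl_comp symplectic_form_eq scaleR_add_left inner_commute)

text \<open>The group law moves the base point to 0 and replaces the test function by
  \<open>weyl (t *\<^sub>R p) \<phi>\<close>, which stays in the class.\<close>

lemma dist_of_weyl_derivative:
  assumes f: "square_integrable f" and \<phi>: "poly_gaussian \<phi>"
  shows "((\<lambda>t. dist_of f (weyl (t *\<^sub>R p) \<phi>)) has_vector_derivative
    dist_of f (weyl_gen p (weyl (t *\<^sub>R p) \<phi>))) (at t)"
  using dist_of_weyl_derivative_0[OF f poly_gaussian_weyl[OF \<phi>], of p "t *\<^sub>R p"]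
  unfolding has_vector_derivative_iff_quotient
  by (simp add: weyl_0 flip: weyl_scaleR_add) (simp add: add.commute)

text \<open>Formally, \<open>- 2 * pi * \<i>\<close> times Q for v is differentiation along
  \<open>snd v\<close> minus multiplication by \<open>2 * pi * \<i> * (fst v \<bullet> x)\<close>.
  Transposition to the test function reverses the sign of the derivative only.\<close>

lemma Q_op_poly_gaussian:
  assumes f: "square_integrable f" and \<phi>: "poly_gaussian \<phi>"
  shows "- 2 * pi * \<i> * Q_op v (dist_of f) \<phi> = dist_of f (weyl_gen (- snd v, - fst v) \<phi>)"
proof -
  note sq = square_integrable_weyl_gen[OF \<phi>]
  have "dist_of f (weyl_gen (- snd v, - fst v) \<phi>)
      = dist_of f (\<lambda>x. \<Sum>k\<in>UNIV. complex_of_real (- (snd v $ k)) * partial_deriv k \<phi> x)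
        + dist_of f (\<lambda>x. (- 2 * pi * \<i>) * (complex_of_real (fst v \<bullet> x) * \<phi> x))"
  proof -
    have "weyl_gen (- snd v, - fst v) \<phi>
      = (\<lambda>x. (\<Sum>k\<in>UNIV. complex_of_real (- (snd v $ k)) * partial_deriv k \<phi> x)
        + (- 2 * pi * \<i>) * (complex_of_real (fst v \<bullet> x) * \<phi> x))"
      by (rule ext) (simp add: weyl_gen_def)
    then show ?thesis
      using f by (simp only:) (intro dist_of_add_right square_integrable_sum square_integrable_scale
        sq)
  qed
  also have "\<dots> = (\<Sum>k\<in>UNIV. complex_of_real (- (snd v $ k)) * dist_of f (partial_deriv k \<phi>))
      + (- 2 * pi * \<i>) * dist_of f (\<lambda>x. complex_of_real (fst v \<bullet> x) * \<phi> x)"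
    using f by (simp only: dist_of_sum_right sq dist_of_scale_right)
  also have "\<dots> = - 2 * pi * \<i> * Q_op v (dist_of f) \<phi>"
    by (simp add: Q_op_def dist_deriv_def dist_mult_def inner_vec_def sum_negf algebra_simps)
  finally show ?thesis ..
qed

text \<open>The map J through which v determines a Weyl group; it preserves the symplectic form, see
  \<open>symplectic_form_dual\<close>.\<close>

definition symplectic_dual :: "(real ^ 'd) \<times> (real ^ 'd) \<Rightarrow> (real ^ 'd) \<times> (real ^ 'd)" where
  "symplectic_dual v = (snd v, - fst v)"

text \<open>A weak version of the fact that the increment of the orbit of f is
  \<open>- 2 * pi * \<i>\<close> times the integral of the orbit of h. Pairing with test functions
  reduces it to a scalar mean value estimate, which density turns into a norm bound.\<close>

lemma weyl_increment_estimate: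
  assumes f: "square_integrable f" and h: "square_integrable h"
    and Q: "dist_represented_by (Q_op v (dist_of f)) h"
    and K: "\<And>s. \<bar>s\<bar> \<le> \<bar>t\<bar> \<Longrightarrow> L2_norm (\<lambda>x. weyl (s *\<^sub>R symplectic_dual v) h x - h x) \<le> K"
  shows "L2_norm (\<lambda>x. weyl (t *\<^sub>R symplectic_dual v) f x - f x + 2 * pi * \<i> * t * h x)
    \<le> 2 * pi * \<bar>t\<bar> * K"
proof -
  let ?J = "symplectic_dual v"
  let ?W = "\<lambda>t. weyl (t *\<^sub>R ?J)"
  let ?c = "2 * complex_of_real pi * \<i>"
  have K0: "0 \<le> K" using order_trans[OF L2_norm_nonneg K[of 0]] by simp
  \<comment> \<open>Weak differentiability of the orbit of f is linear in the test function. For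
    \<open>poly_gaussian\<close> functions it follows by transposing the group to the test function,
    where the hypothesis \<open>Q\<close> applies.\<close>
  define R where "R = (\<lambda>\<phi>. square_integrable \<phi> \<and>
    (\<forall>t. ((\<lambda>t. dist_of (?W t f) \<phi>) has_vector_derivative - ?c * dist_of (?W t h) \<phi>) (at t)))"
  interpret L2_test_space R
  proof
    fix \<phi> \<psi> and c :: complex
    show "R \<phi> \<Longrightarrow> square_integrable \<phi>" by (simp add: R_def)
    show "R \<phi>" if "poly_gaussian \<phi>"
    proof -
      let ?p = "(- snd v, - fst v)"
      have sq: "square_integrable \<phi>" using that by (rule square_integrable_poly_gaussian)
      have tr: "dist_of (?W t k) \<phi> = dist_of k (weyl (t *\<^sub>R ?p) \<phi>)" if "square_integrable k" for k t
        using dist_of_weyl[OF that sq, of "t *\<^sub>R snd v" "- (t *\<^sub>R fst v)"]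
        by (simp add: symplectic_dual_def)
      have "((\<lambda>t. dist_of f (weyl (t *\<^sub>R ?p) \<phi>)) has_vector_derivative
        - ?c * dist_of h (weyl (t *\<^sub>R ?p) \<phi>)) (at t)" for t
      proof -
        have "- ?c * dist_of h (weyl (t *\<^sub>R ?p) \<phi>) = - ?c * Q_op v (dist_of f) (weyl (t *\<^sub>R ?p) \<phi>)"
          using Q schwartz_poly_gaussian[OF poly_gaussian_weyl[OF that]]
            by (simp add: dist_represented_by_def)
        also have "\<dots> = dist_of f (weyl_gen ?p (weyl (t *\<^sub>R ?p) \<phi>))"
          using Q_op_poly_gaussian[OF f poly_gaussian_weyl[OF that]] by simp
        finally show ?thesis using dist_of_weyl_derivative[OF f that, of ?p t] by simp
      qed
      then show ?thesis using sq by (simp add: R_def tr f h)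
    qed
    show "R (\<lambda>x. \<phi> x + \<psi> x)" if "R \<phi>" "R \<psi>"
      using that has_vector_derivative_add unfolding R_def
      by (force simp: dist_of_add_right square_integrable_weyl f h square_integrable_add
        distrib_left)
    show "R (\<lambda>x. c * \<phi> x)" if "R \<phi>"
      using that has_vector_derivative_mult_right[of _ _ _ c] unfolding R_def
      by (force simp: dist_of_scale_right square_integrable_scale mult_ac)
  qed
  define u where "u = (\<lambda>x. ?W t f x - f x + ?c * t * h x)"
  have usq: "square_integrable u"
    unfolding u_def using f h
      by (intro square_integrable_add square_integrable_diff square_integrable_scale
        square_integrable_weyl)
  have bound: "norm (dist_of u \<phi>) \<le> (2 * pi * \<bar>t\<bar> * K) * L2_norm \<phi>" if R: "R \<phi>" for \<phi>
  proof -
    have sq: "square_integrable \<phi>" using R by (simp add: R_def)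
    \<comment> \<open>The linear term makes \<open>?G t - ?G 0\<close> the pairing with u, while the
      derivative at s becomes a multiple of the pairing with \<open>?W s h - h\<close>, which K
      controls.\<close>
    let ?G = "\<lambda>s. dist_of (?W s f) \<phi> + s *\<^sub>R (?c * dist_of h \<phi>)"
    have "norm (?G t - ?G 0) \<le> (2 * pi * K * L2_norm \<phi>) * norm (t - 0)"
    proof (rule differentiable_bound[where S = "{- \<bar>t\<bar>..\<bar>t\<bar>}"])
      fix s assume s: "s \<in> {- \<bar>t\<bar>..\<bar>t\<bar>}"
      let ?D = "- ?c * dist_of (?W s h) \<phi> + ?c * dist_of h \<phi>"
      have "((\<lambda>s. s *\<^sub>R (?c * dist_of h \<phi>)) has_vector_derivative ?c * dist_of h \<phi>) (at s)"
        by (auto intro!: derivative_eq_intros)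
      then have "(?G has_vector_derivative ?D) (at s)"
        using R unfolding R_def by (intro has_vector_derivative_add) auto
      then show "(?G has_derivative (\<lambda>h. h *\<^sub>R ?D)) (at s within {- \<bar>t\<bar>..\<bar>t\<bar>})"
        using has_vector_derivative_at_within unfolding has_vector_derivative_def by blast
      have "?D = - ?c * dist_of (\<lambda>x. ?W s h x - h x) \<phi>"
        using h sq by (simp add: dist_of_diff_left square_integrable_weyl algebra_simps)
      then have "norm ?D = 2 * pi * norm (dist_of (\<lambda>x. ?W s h x - h x) \<phi>)"
        by (simp add: norm_mult)
      also have "\<dots> \<le> 2 * pi * (L2_norm (\<lambda>x. ?W s h x - h x) * L2_norm \<phi>)"
        using h sq by (intro mult_left_mono dist_of_bound square_integrable_diff
          square_integrable_weyl) auto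
      also have "\<dots> \<le> 2 * pi * (K * L2_norm \<phi>)"
        using K[of s] s by (intro mult_left_mono mult_right_mono) (auto simp: L2_norm_nonneg)
      finally have "norm ?D \<le> 2 * pi * K * L2_norm \<phi>" by (simp only: mult.assoc)
      then show "onorm (\<lambda>h. h *\<^sub>R ?D) \<le> 2 * pi * K * L2_norm \<phi>"
        by (intro onorm_le) (simp add: mult.commute[of _ "\<bar>_\<bar>"] mult_left_mono del: of_real_mult)
    qed auto
    moreover have "?G t - ?G 0 = dist_of u \<phi>"
    proof -
      have "dist_of u \<phi> = dist_of (\<lambda>x. ?W t f x - f x) \<phi> + dist_of (\<lambda>x. ?c * t * h x) \<phi>"
        unfolding u_def using f h sq
          by (intro dist_of_add_left square_integrable_diff square_integrable_scale
            square_integrable_weyl)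
      also have "\<dots> = dist_of (?W t f) \<phi> - dist_of f \<phi> + ?c * t * dist_of h \<phi>"
        using f sq by (simp only: dist_of_diff_left dist_of_scale_left square_integrable_weyl)
      finally show ?thesis by (simp add: weyl_0 scaleR_conv_of_real)
    qed
    ultimately show ?thesis by (simp add: mult_ac)
  qed
  let ?M = "2 * pi * \<bar>t\<bar> * K" and ?N = "L2_norm u"
  have M0: "0 \<le> ?M" using K0 by simp
  \<comment> \<open>Since the pairing is bilinear, a test function close to the conjugate of u makes
    it close to \<open>?N\<^sup>2\<close>.\<close>
  have "?N\<^sup>2 \<le> ?M * ?N"
  proof (rule field_le_epsilon)
    fix \<epsilon> :: real assume \<epsilon>: "\<epsilon> > 0"
    \<comment> \<open>Replacing the conjugate of u by \<open>\<phi>\<close> costs at most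
      \<open>(?M + ?N) * \<delta>\<close>, which is to stay below \<open>\<epsilon>\<close>.\<close>
    define \<delta> where "\<delta> = \<epsilon> / (?M + ?N + 1)"
    have pos: "?M + ?N + 1 > 0" using M0 L2_norm_nonneg[of u] by linarith
    have \<delta>: "\<delta> > 0" "(?M + ?N) * \<delta> \<le> \<epsilon>"
      using \<epsilon> pos unfolding \<delta>_def by (simp_all add: pos_divide_le_eq algebra_simps)
    obtain \<phi> where \<phi>: "R \<phi>" "L2_norm (\<lambda>x. cnj (u x) - \<phi> x) < \<delta>"
      using L2_dense[OF square_integrable_cnj[OF usq]] \<delta>(1) unfolding approximable_def by blast
    have sq: "square_integrable \<phi>" using \<phi>(1) by (simp add: R_def)
    let ?r = "\<lambda>x. cnj (u x) - \<phi> x"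
    have r: "square_integrable ?r"
      using square_integrable_diff[OF square_integrable_cnj[OF usq] sq] .
    have "L2_inner u u = dist_of u (\<lambda>x. \<phi> x + ?r x)"
      by (simp add: dist_of_eq_L2_inner)
    also have "\<dots> = dist_of u \<phi> + dist_of u ?r" using usq sq r by (rule dist_of_add_right)
    finally have "?N\<^sup>2 = norm (dist_of u \<phi> + dist_of u ?r)"
      unfolding L2_inner_self by (metis abs_of_nonneg norm_of_real zero_le_power2)
    also have "\<dots> \<le> ?M * L2_norm \<phi> + ?N * L2_norm ?r"
      using bound[OF \<phi>(1)] dist_of_bound[OF usq r] by (rule norm_triangle_le[OF add_mono])
    also have "L2_norm \<phi> \<le> ?N + L2_norm ?r"
    proof -
      have "L2_norm (\<lambda>x. cnj (u x) + - 1 * ?r x)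
        \<le> L2_norm (\<lambda>x. cnj (u x)) + L2_norm (\<lambda>x. - 1 * ?r x)"
        using usq r by (intro L2_norm_triangle square_integrable_cnj square_integrable_scale)
      then show ?thesis by (simp only: L2_norm_cnj L2_norm_scale) simp
    qed
    also have "?M * (?N + L2_norm ?r) + ?N * L2_norm ?r = ?M * ?N + (?M + ?N) * L2_norm ?r"
      by (simp add: algebra_simps)
    also have "\<dots> \<le> ?M * ?N + (?M + ?N) * \<delta>"
      using \<phi>(2) M0 L2_norm_nonneg[of u] by (intro add_left_mono mult_left_mono) auto
    also have "\<dots> \<le> ?M * ?N + \<epsilon>" using \<delta>(2) by simp
    finally show "?N\<^sup>2 \<le> ?M * ?N + \<epsilon>" using M0 by (simp add: mult_left_mono)
  qed
  then have "?N \<le> ?M"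
    using L2_norm_nonneg[of u] M0 by (cases "?N = 0") (auto simp: power2_eq_square)
  then show ?thesis by (simp add: u_def mult.assoc)
qed

text \<open>Division of \<open>weyl_increment_estimate\<close> by
  \<open>2 * pi * \<bar>t\<bar>\<close>; strong continuity of the group at h makes K small. Thus a
  weak hypothesis yields norm convergence.\<close>

lemma weyl_quotient_limit:
  assumes f: "square_integrable f" and h: "square_integrable h"
    and Q: "dist_represented_by (Q_op v (dist_of f)) h"
  shows "((\<lambda>t. L2_norm (\<lambda>x. (weyl (t *\<^sub>R symplectic_dual v) f x - f x) / (- 2 * pi * \<i> * t) - h x))
    \<longlongrightarrow> 0) (at 0)"
proof (rule tendstoI)
  let ?W = "\<lambda>t. weyl (t *\<^sub>R symplectic_dual v)"
  fix \<epsilon> :: real assume \<epsilon>: "\<epsilon> > 0"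
  then obtain \<delta> where \<delta>: "\<delta> > 0" "\<And>t. t \<noteq> 0 \<Longrightarrow> \<bar>t\<bar> < \<delta> \<Longrightarrow> L2_norm (\<lambda>x. ?W t h x - h x) < \<epsilon> / 2"
    using order_tendstoD(2)[OF weyl_strongly_continuous[OF h, of "symplectic_dual v"], of "\<epsilon> / 2"]
    unfolding eventually_at by (auto simp: dist_norm)
  have "L2_norm (\<lambda>x. (?W t f x - f x) / (- 2 * pi * \<i> * t) - h x) < \<epsilon>" if t: "t \<noteq> 0" "\<bar>t\<bar> < \<delta>" for t
  proof -
    \<comment> \<open>The limit at 0 says nothing about \<open>s = 0\<close>, where the difference
      vanishes anyway.\<close>
    have "L2_norm (\<lambda>x. ?W s h x - h x) \<le> \<epsilon> / 2" if "\<bar>s\<bar> \<le> \<bar>t\<bar>" for s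
      using \<delta>(2)[of s] that t \<epsilon>
        by (cases "s = 0") (auto simp: weyl_0 L2_norm_def intro: less_imp_le)
    then have *: "L2_norm (\<lambda>x. ?W t f x - f x + 2 * pi * \<i> * t * h x) \<le> 2 * pi * \<bar>t\<bar> * (\<epsilon> / 2)"
      by (intro weyl_increment_estimate[OF f h Q])
    have "(?W t f x - f x) / (- 2 * pi * \<i> * t) - h x
      = 1 / (- 2 * pi * \<i> * t) * (?W t f x - f x + 2 * pi * \<i> * t * h x)" for x
      using t by (simp add: field_simps)
    then have "L2_norm (\<lambda>x. (?W t f x - f x) / (- 2 * pi * \<i> * t) - h x)
        = 1 / (2 * pi * \<bar>t\<bar>) * L2_norm (\<lambda>x. ?W t f x - f x + 2 * pi * \<i> * t * h x)"
      by (simp only: L2_norm_scale) (simp add: norm_divide norm_mult)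
    also have "\<dots> \<le> 1 / (2 * pi * \<bar>t\<bar>) * (2 * pi * \<bar>t\<bar> * (\<epsilon> / 2))"
      using * by (intro mult_left_mono) auto
    also have "\<dots> < \<epsilon>" using t \<epsilon> by simp
    finally show ?thesis .
  qed
  then show "\<forall>\<^sub>F t in at 0. dist (L2_norm (\<lambda>x. (?W t f x - f x) / (- 2 * pi * \<i> * t) - h x)) 0 < \<epsilon>"
    unfolding eventually_at using \<delta>(1) by (intro exI[of _ \<delta>]) (auto simp: dist_norm L2_norm_nonneg)
qed

section \<open>The commutator of two generators\<close>

lemma L2_norm_0: "L2_norm (\<lambda>x. 0) = 0"
  by (simp add: L2_norm_def)

lemma L2_inner_tendsto:
  assumes a: "\<And>t. square_integrable (a t)" "square_integrable a'"
    and b: "\<And>t. square_integrable (b t)" "square_integrable b'"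
    and lim: "((\<lambda>t. L2_norm (\<lambda>x. a t x - a' x)) \<longlongrightarrow> 0) F" "((\<lambda>t. L2_norm (\<lambda>x. b t x - b' x)) \<longlongrightarrow> 0) F"
  shows "((\<lambda>t. L2_inner (a t) (b t)) \<longlongrightarrow> L2_inner a' b') F"
proof (rule LIM_zero_cancel, rule Lim_null_comparison)
  let ?A = "\<lambda>t. L2_norm (\<lambda>x. a t x - a' x)" and ?B = "\<lambda>t. L2_norm (\<lambda>x. b t x - b' x)"
  have "norm (L2_inner (a t) (b t) - L2_inner a' b')
    \<le> ?A t * (?B t + L2_norm b') + L2_norm a' * ?B t" for t
  proof -
    have "L2_inner (a t) (b t) - L2_inner a' b'
        = L2_inner (\<lambda>x. a t x - a' x) (b t) + L2_inner a' (\<lambda>x. b t x - b' x)"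
      using a b by (simp add: L2_inner_diff_left L2_inner_diff_right)
    also have "norm \<dots> \<le> ?A t * L2_norm (b t) + L2_norm a' * ?B t"
      using a b by (intro norm_triangle_le add_mono L2_Cauchy_Schwarz square_integrable_diff)
    also have "L2_norm (b t) \<le> ?B t + L2_norm b'"
      using L2_norm_triangle[of "\<lambda>x. b t x - b' x" b'] b by (simp add: square_integrable_diff)
    finally show ?thesis by (simp add: mult_left_mono L2_norm_nonneg)
  qed
  then show "\<forall>\<^sub>F t in F. norm (L2_inner (a t) (b t) - L2_inner a' b')
    \<le> ?A t * (?B t + L2_norm b') + L2_norm a' * ?B t"
    by simp
  show "((\<lambda>t. ?A t * (?B t + L2_norm b') + L2_norm a' * ?B t) \<longlongrightarrow> 0) F"
    using lim by (auto intro!: tendsto_eq_intros)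
qed

text \<open>Constant families in \<open>L2_inner_tendsto\<close>, with uniqueness of limits.\<close>

lemma L2_inner_cong_null:
  assumes "square_integrable a" "square_integrable a'" "square_integrable b" "square_integrable b'"
    and "L2_norm (\<lambda>x. a x - a' x) = 0" "L2_norm (\<lambda>x. b x - b' x) = 0"
  shows "L2_inner a b = L2_inner a' b'"
proof -
  have "((\<lambda>t::nat. L2_inner a b) \<longlongrightarrow> L2_inner a' b') sequentially"
    using assms by (intro L2_inner_tendsto) auto
  then show ?thesis by (simp add: LIMSEQ_const_iff)
qed

section \<open>Symplectic algebra and difference quotients of the Weyl groups\<close>

lemma symplectic_form_commute: "symplectic_form q p = - symplectic_form p q"
  by (simp add: symplectic_form_eq inner_commute)

lemma symplectic_form_scaleR [simp]:
  "symplectic_form (t *\<^sub>R p) q = t * symplectic_form p q"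
  "symplectic_form p (t *\<^sub>R q) = t * symplectic_form p q"
  by (simp_all add: symplectic_form_eq algebra_simps)

lemma symplectic_form_minus [simp]:
  "symplectic_form (- p) q = - symplectic_form p q"
  "symplectic_form p (- q) = - symplectic_form p q"
  by (simp_all add: symplectic_form_eq)

lemma symplectic_form_dual [simp]:
  "symplectic_form (symplectic_dual v) (symplectic_dual w) = symplectic_form v w"
  by (simp add: symplectic_form_eq symplectic_dual_def inner_commute)

lemma weyl_commute:
  "weyl p (weyl q f) = (\<lambda>x. cis (2 * pi * symplectic_form p q) * weyl q (weyl p f) x)"
proof -
  have "cis (pi * symplectic_form p q)
    = cis (2 * pi * symplectic_form p q) * cis (pi * symplectic_form q p)"
    by (simp add: cis_mult symplectic_form_commute[of q p])
  then show ?thesis by (simp add: weyl_comp add.commute mult.assoc)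
qed

lemma filterlim_uminus_at_0: "filterlim uminus (at (0::real)) (at 0)"
  by (auto simp: filterlim_at eventually_at intro!: tendsto_eq_intros exI[of _ 1])

definition weyl_quotient where
  "weyl_quotient v t f = (\<lambda>x. (weyl (t *\<^sub>R symplectic_dual v) f x - f x) / (- 2 * pi * \<i> * t))"

lemma weyl_quotient_eq:
  "weyl_quotient v t f = (\<lambda>x. (\<i> / (2 * pi * t)) * (weyl (t *\<^sub>R symplectic_dual v) f x - f x))"
proof -
  have "z / (- 2 * pi * \<i> * t) = (\<i> / (2 * pi * t)) * z" for z
  proof -
    have "z / (- 2 * pi * \<i> * t) = (z / \<i>) / (- (2 * pi * t))"
      unfolding divide_divide_eq_left by (simp add: mult_ac)
    then show ?thesis by simp
  qed
  then show ?thesis by (simp add: weyl_quotient_def)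
qed

lemma square_integrable_weyl_quotient:
  "square_integrable f \<Longrightarrow> square_integrable (weyl_quotient v t f)"
  unfolding weyl_quotient_eq
    by (intro square_integrable_scale square_integrable_diff square_integrable_weyl)

lemma weyl_quotient_tendsto:
  assumes "square_integrable f" "square_integrable h" "dist_represented_by (Q_op v (dist_of f)) h"
  shows "((\<lambda>t. L2_norm (\<lambda>x. weyl_quotient v t f x - h x)) \<longlongrightarrow> 0) (at 0)"
    and "((\<lambda>t. L2_norm (\<lambda>x. weyl_quotient v (- t) f x - h x)) \<longlongrightarrow> 0) (at 0)"
proof -
  show *: "((\<lambda>t. L2_norm (\<lambda>x. weyl_quotient v t f x - h x)) \<longlongrightarrow> 0) (at 0)"
    using weyl_quotient_limit[OF assms] by (simp add: weyl_quotient_def)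
  show "((\<lambda>t. L2_norm (\<lambda>x. weyl_quotient v (- t) f x - h x)) \<longlongrightarrow> 0) (at 0)"
    by (rule filterlim_compose[OF * filterlim_uminus_at_0])
qed

text \<open>Moving the group element across the inner product and past \<open>weyl p\<close> turns
  the quotient at t into the quotient at \<open>- t\<close> in the other argument, up to a phase
  \<open>?e t\<close> that tends to 1.\<close>

lemma L2_inner_generator_reflect:
  assumes g: "square_integrable g" and h: "square_integrable h"
    and Q: "dist_represented_by (Q_op v (dist_of g)) h"
    and p: "p = 0 \<or> L2_inner g (weyl p g) = 0"
  shows "L2_inner h (weyl p g) = L2_inner (weyl (- p) g) h"
proof -
  let ?J = "symplectic_dual v"
  let ?e = "\<lambda>t. cis (2 * pi * (t * symplectic_form ?J p))"
  note sq = g h square_integrable_weyl square_integrable_weyl_quotient square_integrable_diff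
  have "L2_inner (weyl_quotient v t g) (weyl p g)
    = ?e t * L2_inner (weyl (- p) g) (weyl_quotient v (- t) g)" for t
  proof -
    have "L2_inner (weyl (t *\<^sub>R ?J) g) (weyl p g) = L2_inner g (weyl (- (t *\<^sub>R ?J)) (weyl p g))"
      by (intro L2_inner_weyl_left sq)
    also have "\<dots> = ?e t * L2_inner g (weyl p (weyl (- (t *\<^sub>R ?J)) g))"
      by (subst weyl_commute)
        (simp only: L2_inner_scale_right symplectic_form_minus symplectic_form_scaleR cis_cnj
          mult_minus_right minus_minus)
    also have "L2_inner g (weyl p (weyl (- (t *\<^sub>R ?J)) g))
      = L2_inner (weyl (- p) g) (weyl (- (t *\<^sub>R ?J)) g)"
      by (intro L2_inner_weyl_right sq)
    finally have 1: "L2_inner (weyl (t *\<^sub>R ?J) g) (weyl p g)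
      = ?e t * L2_inner (weyl (- p) g) (weyl (- (t *\<^sub>R ?J)) g)" .
    \<comment> \<open>The only place where the condition on p enters: the subtracted terms of the
      quotients carry no phase of their own. For \<open>p = 0\<close> the phase is 1, otherwise both
      sides vanish.\<close>
    have 2: "L2_inner g (weyl p g) = ?e t * L2_inner (weyl (- p) g) g"
      using p L2_inner_weyl_right[OF g g, of p] by (auto simp: symplectic_form_eq)
    show ?thesis
      unfolding weyl_quotient_eq L2_inner_scale_left L2_inner_scale_right
      by (simp add: L2_inner_diff_left L2_inner_diff_right sq 1 2 right_diff_distrib mult_ac)
  qed
  then have "((\<lambda>t. ?e t * L2_inner (weyl (- p) g) (weyl_quotient v (- t) g))
    \<longlongrightarrow> L2_inner h (weyl p g)) (at 0)"
    using L2_inner_tendsto[of "\<lambda>t. weyl_quotient v t g" h "\<lambda>_. weyl p g" "weyl p g" "at 0"]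
    by (simp add: sq weyl_quotient_tendsto[OF g h Q] L2_norm_0)
  moreover have "((\<lambda>t. ?e t * L2_inner (weyl (- p) g) (weyl_quotient v (- t) g))
      \<longlongrightarrow> cis (2 * pi * (0 * symplectic_form ?J p)) * L2_inner (weyl (- p) g) h) (at 0)"
  proof (rule tendsto_mult)
    show "(?e \<longlongrightarrow> cis (2 * pi * (0 * symplectic_form ?J p))) (at 0)"
      unfolding cis_conv_exp by (intro tendsto_intros)
    show "((\<lambda>t. L2_inner (weyl (- p) g) (weyl_quotient v (- t) g))
      \<longlongrightarrow> L2_inner (weyl (- p) g) h) (at 0)"
      using L2_inner_tendsto[of "\<lambda>_. weyl (- p) g" "weyl (- p) g" "\<lambda>t. weyl_quotient v (- t) g" h
        "at 0"]
      by (simp add: sq weyl_quotient_tendsto[OF g h Q] L2_norm_0)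
  qed
  ultimately have "L2_inner h (weyl p g)
    = cis (2 * pi * (0 * symplectic_form ?J p)) * L2_inner (weyl (- p) g) h"
    by (rule tendsto_unique[rotated]) simp
  then show ?thesis by simp
qed

text \<open>The two inner products differ by phases; this turns orthonormality into the condition of
  \<open>L2_inner_generator_reflect\<close>.\<close>

lemma L2_inner_transl_mod_eq_0_iff:
  assumes "square_integrable g"
  shows "L2_inner (transl_mod q g) (transl_mod p g) = 0 \<longleftrightarrow> L2_inner g (weyl (p - q) g) = 0"
proof -
  have "L2_inner (weyl q g) (weyl p g) = L2_inner g (weyl (- q) (weyl p g))"
    using assms by (intro L2_inner_weyl_left square_integrable_weyl)
  also have "\<dots> = cnj (cis (pi * symplectic_form (- q) p)) * L2_inner g (weyl (p - q) g)"
    by (simp add: weyl_comp L2_inner_scale_right)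
  finally show ?thesis
    unfolding transl_mod_eq_weyl L2_inner_scale_left L2_inner_scale_right by simp
qed

lemma orthonormal_basis_generators_symmetric:
  assumes \<Lambda>: "\<Lambda> = uminus ` \<Lambda>" "\<mu> \<in> \<Lambda>"
    and onb: "L2_orthonormal_basis \<Lambda> (\<lambda>p. transl_mod p g)"
    and g: "square_integrable g"
    and v: "square_integrable hv" "dist_represented_by (Q_op v (dist_of g)) hv"
    and w: "square_integrable hw" "dist_represented_by (Q_op w (dist_of g)) hw"
  shows "L2_inner hv hw = L2_inner hw hv"
proof -
  have orth: "p - \<mu> = 0 \<or> L2_inner g (weyl (p - \<mu>) g) = 0" if "p \<in> \<Lambda>" for p
    using onb \<Lambda>(2) that L2_inner_transl_mod_eq_0_iff[OF g, of \<mu> p]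
    by (cases "p = \<mu>") (auto simp: L2_orthonormal_basis_def)
  let ?F = "\<lambda>p. L2_inner hw (weyl (p + \<mu>) g) * L2_inner (weyl (p + \<mu>) g) hv"
  have "((\<lambda>p. L2_inner hv (weyl (p + - \<mu>) g) * L2_inner (weyl (p +
    - \<mu>) g) hw) has_sum L2_inner hv hw) \<Lambda>"
    by (rule L2_Parseval_weyl[OF onb g v(1) w(1)])
  \<comment> \<open>Reflecting both factors exchanges their roles: the term at p is the term at
    \<open>- p\<close> in the expansion of \<open>\<langle>hw, hv\<rangle>\<close> with the opposite
    shift.\<close>
  moreover have "L2_inner hv (weyl (p + - \<mu>) g) * L2_inner (weyl (p + - \<mu>) g) hw = (?F \<circ> uminus) p"
    if "p \<in> \<Lambda>" for p
  proof -
    have "L2_inner hv (weyl (p - \<mu>) g) = L2_inner (weyl (- p + \<mu>) g) hv"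
      using L2_inner_generator_reflect[OF g v orth[OF that]] by (simp add: add.commute)
    moreover have "L2_inner (weyl (p - \<mu>) g) hw = L2_inner hw (weyl (- p + \<mu>) g)"
      using L2_inner_generator_reflect[OF g w orth[OF that]]
      by (subst L2_inner_commute, subst (2) L2_inner_commute) (simp add: add.commute)
    ultimately show ?thesis by (simp add: mult.commute)
  qed
  ultimately have "((?F \<circ> uminus) has_sum L2_inner hv hw) \<Lambda>"
    by (subst (asm) has_sum_cong) auto
  then have "(?F has_sum L2_inner hv hw) (uminus ` \<Lambda>)"
    by (subst has_sum_reindex) auto
  then have "(?F has_sum L2_inner hv hw) \<Lambda>" using \<Lambda>(1) by simp
  moreover have "(?F has_sum L2_inner hw hv) \<Lambda>"
    by (rule L2_Parseval_weyl[OF onb g w(1) v(1)])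
  ultimately show ?thesis by (rule has_sum_unique)
qed

text \<open>The derivative of \<open>sin (c * u)\<close> at \<open>u = 0\<close>, along
  \<open>u = t\<^sup>2\<close>.\<close>

lemma sin_square_quotient_tendsto:
  "((\<lambda>t. sin (c * t\<^sup>2) / t\<^sup>2) \<longlongrightarrow> c) (at (0::real))"
proof -
  have "((\<lambda>u. sin (c * u)) has_real_derivative c) (at 0)"
    by (auto intro!: derivative_eq_intros)
  then have "((\<lambda>u. sin (c * u) / u) \<longlongrightarrow> c) (at 0)" by (simp add: DERIV_def)
  moreover have "filterlim (\<lambda>t::real. t\<^sup>2) (at 0) (at 0)"
    by (auto simp: filterlim_at eventually_at intro!: tendsto_eq_intros exI[of _ 1])
  ultimately show ?thesis by (rule filterlim_compose)
qed

text \<open>The second pairing is taken at \<open>- t\<close>, so that its main term is the same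
  inner product as in the first, with the opposite phase. Only first-order quotients at g occur;
  products of the two generators, which need not be defined at g, are avoided.\<close>

lemma generators_commutator:
  assumes g: "square_integrable g"
    and v: "square_integrable hv" "dist_represented_by (Q_op v (dist_of g)) hv"
    and w: "square_integrable hw" "dist_represented_by (Q_op w (dist_of g)) hw"
  shows "L2_inner hv hw - L2_inner hw hv = \<i> * symplectic_form v w / (2 * pi) * L2_inner g g"
proof -
  let ?\<Omega> = "symplectic_form v w"
  let ?P = "\<lambda>t. t *\<^sub>R symplectic_dual v" and ?R = "\<lambda>t. t *\<^sub>R symplectic_dual w"
  let ?k = "symplectic_dual w - symplectic_dual v"
  note sq = g square_integrable_weyl square_integrable_weyl_quotient square_integrable_diff v(1)
    w(1)
  have eq: "L2_inner (weyl_quotient v t g) (weyl_quotient w t g)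
    - L2_inner (weyl_quotient w (- t) g) (weyl_quotient v (- t) g)
      = complex_of_real (sin (pi * ?\<Omega> * t\<^sup>2) / t\<^sup>2) * (\<i> / (2 * pi\<^sup>2) * L2_inner g (weyl (t *\<^sub>R ?k)
        g))" for t
  proof -
    let ?W = "L2_inner g (weyl (t *\<^sub>R ?k) g)"
    have 1: "L2_inner (weyl (?P t) g) (weyl (?R t) g) = cis (pi * ?\<Omega> * t\<^sup>2) * ?W"
    proof -
      have "L2_inner (weyl (?P t) g) (weyl (?R t) g) = L2_inner g (weyl (- ?P t) (weyl (?R t) g))"
        by (intro L2_inner_weyl_left sq)
      also have "weyl (- ?P t) (weyl (?R t) g)
        = (\<lambda>x. cis (- (pi * ?\<Omega> * t\<^sup>2)) * weyl (t *\<^sub>R ?k) g x)"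
        by (simp add: weyl_comp scaleR_diff_right power2_eq_square mult_ac)
      also have "L2_inner g \<dots> = cis (pi * ?\<Omega> * t\<^sup>2) * ?W"
        by (simp only: L2_inner_scale_right cis_cnj minus_minus)
      finally show ?thesis .
    qed
    have 2: "L2_inner (weyl (- ?R t) g) (weyl (- ?P t) g) = cis (- (pi * ?\<Omega> * t\<^sup>2)) * ?W"
    proof -
      have "L2_inner (weyl (- ?R t) g) (weyl (- ?P t) g)
        = L2_inner g (weyl (- (- ?R t)) (weyl (- ?P t) g))"
        by (intro L2_inner_weyl_left sq)
      also have "weyl (- (- ?R t)) (weyl (- ?P t) g)
        = (\<lambda>x. cis (pi * ?\<Omega> * t\<^sup>2) * weyl (t *\<^sub>R ?k) g x)"
        by (simp add: weyl_comp scaleR_diff_right power2_eq_square symplectic_form_commute[of w v]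
          mult_ac)
      also have "L2_inner g \<dots> = cis (- (pi * ?\<Omega> * t\<^sup>2)) * ?W"
        by (simp only: L2_inner_scale_right cis_cnj)
      finally show ?thesis .
    qed
    \<comment> \<open>The terms with a single translated factor agree in both pairings and drop out
      of the difference.\<close>
    have 3: "L2_inner (weyl (?P t) g) g = L2_inner g (weyl (- ?P t) g)"
      "L2_inner g (weyl (?R t) g) = L2_inner (weyl (- ?R t) g) g"
      by (intro L2_inner_weyl_left L2_inner_weyl_right sq)+
    have 4: "cis (pi * ?\<Omega> * t\<^sup>2) * ?W - cis (- (pi * ?\<Omega> * t\<^sup>2)) * ?W
      = 2 * \<i> * sin (pi * ?\<Omega> * t\<^sup>2) * ?W"
      by (simp add: cis.ctr complex_eq_iff algebra_simps)
    let ?c = "1 / (2 * pi * t)\<^sup>2"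
    \<comment> \<open>One prefactor occurs conjugated, so the product is positive and the same for
      \<open>s = t\<close> and \<open>s = - t\<close>.\<close>
    have c: "(\<i> / complex_of_real (2 * pi * s)) * (cnj (\<i> / complex_of_real (2 * pi * s)) * z)
      = complex_of_real (1 / (2 * pi * s)\<^sup>2) * z" for s z
      by (simp add: power2_eq_square)
    have "L2_inner (weyl_quotient v t g) (weyl_quotient w t g)
      - L2_inner (weyl_quotient w (- t) g) (weyl_quotient v (- t) g)
       = complex_of_real ?c * (L2_inner (\<lambda>x. weyl (?P t) g x - g x) (\<lambda>x. weyl (?R t) g x - g x)
          - L2_inner (\<lambda>x. weyl (- ?R t) g x - g x) (\<lambda>x. weyl (- ?P t) g x - g x))"
      unfolding weyl_quotient_eq L2_inner_scale_left L2_inner_scale_right c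
      by (simp add: right_diff_distrib)
    also have "L2_inner (\<lambda>x. weyl (?P t) g x - g x) (\<lambda>x. weyl (?R t) g x - g x)
          - L2_inner (\<lambda>x. weyl (- ?R t) g x - g x) (\<lambda>x. weyl (- ?P t) g x - g x)
        = L2_inner (weyl (?P t) g) (weyl (?R t) g) - L2_inner (weyl (- ?R t) g) (weyl (- ?P t) g)"
      by (simp add: L2_inner_diff_left L2_inner_diff_right sq 3)
    also have "\<dots> = 2 * \<i> * sin (pi * ?\<Omega> * t\<^sup>2) * ?W" unfolding 1 2 by (rule 4)
    finally show ?thesis by (simp add: power_mult_distrib mult_ac)
  qed
  have "((\<lambda>t. L2_inner (weyl_quotient v t g) (weyl_quotient w t g)
    - L2_inner (weyl_quotient w (- t) g) (weyl_quotient v (- t) g))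
      \<longlongrightarrow> L2_inner hv hw - L2_inner hw hv) (at 0)"
    by (intro tendsto_diff L2_inner_tendsto sq weyl_quotient_tendsto v w)
  moreover have "((\<lambda>t. complex_of_real (sin (pi * ?\<Omega> * t\<^sup>2) / t\<^sup>2) * (\<i> / (2 * pi\<^sup>2) * L2_inner g
    (weyl (t *\<^sub>R ?k) g)))
      \<longlongrightarrow> complex_of_real (pi * ?\<Omega>) * (\<i> / (2 * pi\<^sup>2) * L2_inner g g)) (at 0)"
    by (intro tendsto_mult tendsto_of_real sin_square_quotient_tendsto tendsto_const
      L2_inner_tendsto sq
        weyl_strongly_continuous) (simp add: L2_norm_def)
  ultimately have "L2_inner hv hw - L2_inner hw hv
    = complex_of_real (pi * ?\<Omega>) * (\<i> / (2 * pi\<^sup>2) * L2_inner g g)"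
    unfolding eq by (rule tendsto_unique[rotated]) simp
  then show ?thesis by (simp add: power2_eq_square)
qed

lemma generator_null_imp_null:
  assumes g: "square_integrable g" and h: "square_integrable h" "L2_norm h = 0"
    and Q: "dist_represented_by (Q_op v (dist_of g)) h" and \<Omega>: "symplectic_form v w \<noteq> 0"
  shows "L2_inner g g = 0"
proof -
  let ?P = "\<lambda>t. t *\<^sub>R symplectic_dual v" and ?R = "\<lambda>t. t *\<^sub>R symplectic_dual w"
  note sq = g square_integrable_weyl square_integrable_diff h(1)
  have inv: "L2_norm (\<lambda>x. weyl (?P t) g x - g x) = 0" for t
  proof -
    \<comment> \<open>For null h the increment estimate holds with \<open>K = 0\<close>, which makes
      g invariant up to null functions.\<close>
    have *: "L2_norm (\<lambda>x. weyl (?P s) h x - h x) \<le> 0" for s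
      using L2_norm_triangle_diff[of "weyl (?P s) h" "\<lambda>x. 0" h] h L2_norm_scale[of "-1" h]
      by (simp add: sq square_integrable_0 L2_norm_weyl L2_norm_minus_commute[of "\<lambda>x. 0"])
    have "L2_norm (\<lambda>x. weyl (?P t) g x - g x + 2 * pi * \<i> * t * h x) \<le> 2 * pi * \<bar>t\<bar> * 0"
      by (rule weyl_increment_estimate[OF g h(1) Q *])
    moreover have "L2_norm (\<lambda>x. (weyl (?P t) g x - g x + 2 * pi * \<i> * t * h x) +
      - (2 * pi * \<i> * t) * h x)
        \<le> L2_norm (\<lambda>x. weyl (?P t) g x - g x + 2 * pi * \<i> * t * h x) + L2_norm (\<lambda>x.
          - (2 * pi * \<i> * t) * h x)"
      by (intro L2_norm_triangle square_integrable_add square_integrable_scale sq)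
    moreover have "L2_norm (\<lambda>x. - (2 * pi * \<i> * t) * h x) = 0"
      by (simp only: L2_norm_scale h mult_zero_right)
    ultimately have "L2_norm (\<lambda>x. weyl (?P t) g x - g x) \<le> 0" by simp
    then show ?thesis using L2_norm_nonneg[of "\<lambda>x. weyl (?P t) g x - g x"] by simp
  qed
  have 0: "L2_inner (weyl (?R s) g) g = 0" if "s \<noteq> 0" for s
  proof -
    \<comment> \<open>Chosen so that commuting \<open>weyl (?P ?t)\<close> with
      \<open>weyl (?R s)\<close> produces the factor \<open>cis pi\<close>, that is, -1.\<close>
    let ?t = "1 / (2 * s * symplectic_form v w)"
    have "L2_inner (weyl (?R s) g) g = L2_inner (weyl (?P ?t) (weyl (?R s) g)) (weyl (?P ?t) g)"
      by (intro L2_inner_weyl[symmetric] sq)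
    also have "\<dots> = cis pi * L2_inner (weyl (?R s) (weyl (?P ?t) g)) (weyl (?P ?t) g)"
    proof -
      have "2 * pi * symplectic_form (?P ?t) (?R s) = pi" using that \<Omega> by simp
      then show ?thesis by (simp only: weyl_commute[of "?P ?t" "?R s"] L2_inner_scale_left)
    qed
    \<comment> \<open>Invariance replaces \<open>weyl (?P ?t) g\<close> by g in both arguments, so
      the inner product equals its own negative.\<close>
    also have "L2_inner (weyl (?R s) (weyl (?P ?t) g)) (weyl (?P ?t) g)
      = L2_inner (weyl (?R s) g) g"
      by (intro L2_inner_cong_null sq inv) (simp only: L2_norm_weyl sq inv flip: weyl_diff)
    finally show ?thesis by simp
  qed
  have "((\<lambda>s. L2_inner (weyl (?R s) g) g) \<longlongrightarrow> L2_inner g g) (at 0)"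
    by (intro L2_inner_tendsto sq weyl_strongly_continuous) (simp add: L2_norm_def)
  moreover have "((\<lambda>s. L2_inner (weyl (?R s) g) g) \<longlongrightarrow> 0) (at 0)"
    by (rule tendsto_eventually) (auto simp: eventually_at 0 intro!: exI[of _ 1])
  ultimately show ?thesis by (rule tendsto_unique[rotated]) simp
qed

section \<open>Finite norms and the final contradiction\<close>

lemma dist_L2_norm_finiteE:
  assumes "dist_L2_norm T \<noteq> \<infinity>"
  obtains h where "square_integrable h" "dist_represented_by T h" "dist_L2_norm T
    = ennreal (L2_norm h)"
proof -
  let ?P = "\<lambda>h. square_integrable h \<and> dist_represented_by T h"
  have ex: "\<exists>h. ?P h" using assms by (auto simp: dist_L2_norm_def split: if_splits)
  then have "dist_L2_norm T = ennreal (L2_norm (SOME h. ?P h))" by (simp add: dist_L2_norm_def)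
  then show ?thesis using that someI_ex[OF ex] by blast
qed

theorem theorem3p6:
  fixes \<Lambda> :: "((real ^ 'd) \<times> (real ^ 'd)) set"
    and g :: "real ^ 'd \<Rightarrow> complex"
    and v w :: "(real ^ 'd) \<times> (real ^ 'd)"
  assumes "countable \<Lambda>"
    and "\<Lambda> = uminus ` \<Lambda>"
    and "square_integrable g"
    and "L2_orthonormal_basis \<Lambda> (\<lambda>p. transl_mod p g)"
    and "symplectic_form v w \<noteq> 0"
  shows "dist_L2_norm (Q_op v (dist_of g)) * dist_L2_norm (Q_op w (dist_of g)) = \<infinity>"
proof -
  let ?N = "\<lambda>v. dist_L2_norm (Q_op v (dist_of g))"
  note g = assms(3)
  \<comment> \<open>With an empty index set the zero function would have to approximate the
    indicator of the unit cube, whose norm is 1.\<close>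
  have "\<Lambda> \<noteq> {}"
  proof
    assume "\<Lambda> = {}"
    let ?C = "cbox 0 One :: (real ^ 'd) set"
    have "square_integrable (indicator ?C)"
      using emeasure_lborel_cbox_finite[of 0 "One :: real ^ 'd"]
      by (intro square_integrable_indicator) (auto simp: less_top)
    then obtain F :: "((real ^ 'd) \<times> (real ^ 'd)) set" and c
      where "F \<subseteq> \<Lambda>" "L2_norm (\<lambda>x. indicator ?C x - (\<Sum>p\<in>F. c p * transl_mod p g x)) < 1"
      using assms(4) zero_less_one unfolding L2_orthonormal_basis_def by blast
    then have "L2_norm (indicator ?C) < 1" using \<open>\<Lambda> = {}\<close> by simp
    moreover have "(norm (indicator ?C x :: complex))\<^sup>2 = indicat_real ?C x" for x
      by (simp add: indicator_def)
    ultimately show False by (simp add: L2_norm_def)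
  qed
  then obtain \<mu> where \<mu>: "\<mu> \<in> \<Lambda>" by blast
  have gg: "L2_inner g g \<noteq> 0"
  proof -
    have "L2_inner (transl_mod \<mu> g) (transl_mod \<mu> g) \<noteq> 0"
      using assms(4) \<mu> by (simp add: L2_orthonormal_basis_def)
    then show ?thesis using L2_inner_transl_mod_eq_0_iff[OF g, of \<mu> \<mu>] by (simp add: weyl_0)
  qed
  \<comment> \<open>Stated for arbitrary vectors so that, by antisymmetry of the form, it applies to
    both factors of the product.\<close>
  have nz: "?N v \<noteq> 0" if "symplectic_form v w \<noteq> 0" for v w
  proof
    assume 0: "?N v = 0"
    then obtain h where h: "square_integrable h" "dist_represented_by (Q_op v (dist_of g)) h" "?N v
      = ennreal (L2_norm h)"
      using dist_L2_norm_finiteE[of "Q_op v (dist_of g)"] by auto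
    then have "L2_norm h = 0" using 0 L2_norm_nonneg[of h] by simp
    then show False using generator_null_imp_null[OF g h(1) _ h(2) that] gg by simp
  qed
  have "?N v = \<infinity> \<or> ?N w = \<infinity>"
  proof (rule ccontr)
    assume "\<not> ?thesis"
    then obtain hv hw where v: "square_integrable hv" "dist_represented_by (Q_op v (dist_of g)) hv"
      and w: "square_integrable hw" "dist_represented_by (Q_op w (dist_of g)) hw"
      by (meson dist_L2_norm_finiteE)
    have "L2_inner hv hw - L2_inner hw hv = 0"
      using orthonormal_basis_generators_symmetric[OF assms(2) \<mu> assms(4) g v w] by simp
    then show False using generators_commutator[OF g v w] assms(5) gg by simp
  qed
  moreover have "?N v \<noteq> 0" "?N w \<noteq> 0"
    using nz assms(5) symplectic_form_commute[of w v] by (metis neg_equal_0_iff_equal)+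
  ultimately show ?thesis by (auto simp: ennreal_mult_eq_top_iff)
qed

end
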